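(* Let $\mathcal{Z}=\{z_n\}$ be a sequence in the unit disc $\mathbb{D}$. With the conditions (OB), (CB), (ROB) taken with respect to the Dirichlet space, the following implications hold: \[ \mathcal{Z}\text{ satisfies (OB)} \implies \mathcal{Z}\text{ satisfies (CB)} \implies \mathcal{Z}\text{ satisfies (ROB)}. \] Furthermore, neither implication is reversible, even for weakly separated sequences: there exists a weakly separated sequence in $\mathbb{D}$ which satisfies (CB) but not (OB), and there exists a weakly separated sequence in $\mathbb{D}$ which satisfies (ROB) but not (CB).
   Context: $\mathbb{D}$ is the open unit disc in $\mathbb{C}$ and $\mathbb{T}$ the unit circle. The Dirichlet space $\mathcal{D}$ is the space of analytic functions $f$ in $\mathbb{D}$ with $\int_{\mathbb{D}}|f'|^2\,dA<\infty$ ($dA$ is area measure), with the inner product \[\langle f,g\rangle_{\mathcal{D}}=\frac1\pi\int_{\mathbb{D}}f'\overline{g'}\,dA+\lim_{r\to1^-}\frac{1}{2\pi}\int_0^{2\pi}f(re^{i\theta})\overline{g(re^{i\theta})}\,d\theta .\] It is a reproducing kernel Hilbert space with kernel \[K_{\mathcal{D}}(z,w)=\frac{1}{z\bar w}\log\frac{1}{1-z\bar w},\qquad z,w\in\mathbb{D},\] (principal branch of the logarithm, with value $1$ when $z\bar w=0$). For a sequence $\mathcal{Z}=\{z_n\}_{n\ge 1}\subseteq\mathbb{D}$, the Gram matrix is $G=(g_{nm})$ with \[g_{nm}=\frac{K_{\mathcal{D}}(z_n,z_m)}{\sqrt{K_{\mathcal{D}}(z_n,z_n)K_{\mathcal{D}}(z_m,z_m)}},\]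 and the associated measure is $\mu_{\mathcal{Z}}=\sum_{n}\delta_{z_n}/K_{\mathcal{D}}(z_n,z_n)$, where $\delta_z$ is the Dirac mass at $z$. The sequence is weakly separated if $\sup_{n\ne m}|g_{nm}|<1$. For an arc $I\subseteq\mathbb{T}$, $|I|$ denotes its normalized length (so $|\mathbb{T}|=1$), and the Carleson box of $I$ is $S(I)=\{z\in\mathbb{D}\setminus\{0\}: z/|z|\in I,\ 1-|z|\le|I|\}$. For $\delta\in(0,1)$, $I^\delta$ is the arc with the same midpoint as $I$ and length $|I|^\delta$. For $z_n\neq0$, $I_n$ is the arc with midpoint $z_n/|z_n|$ and length $1-|z_n|$. (OB) (one box condition): $\mu_{\mathcal{Z}}$ is a finite measure and there is a constant $C>0$ such that $\mu_{\mathcal{Z}}(S(I))\le C\left(\log\frac{1}{|I|}\right)^{-1}$ for all arcs $I\subseteq\mathbb{T}$ with $0<|I|<1$. (CB) (column bounded): $G$ is bounded as a linear operator from $\ell^2(\mathbb{N})$ to $\ell^\infty(\mathbb{N})$; equivalently, $\sup_n\sum_m|g_{nm}|^2<\infty$. (ROB) (restricted one box condition): $\mu_{\mathcal{Z}}$ is a finite measure and there exist $C>0$ and $\delta\in(0,1)$ such that $\mu_{\mathcal{Z}}(S(I_n^\delta))\le C\left(\log\frac{1}{1-|z_n|}\right)^{-1}$ for all $n$ with $z_n\neq 0$. *)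

theory Defs
  imports "HOL-Analysis.Analysis"
begin

section \<open>Kernel, Gram matrix and associated measure\<close>

definition dirichlet_kernel :: "complex \<Rightarrow> complex \<Rightarrow> complex" where
  "dirichlet_kernel z w =
     (if z * cnj w = 0 then 1 else 1 / (z * cnj w) * Ln (1 / (1 - z * cnj w)))"

lemma dirichlet_kernel_diag:
  assumes "cmod z < 1" "z \<noteq> 0"
  shows "dirichlet_kernel z z = of_real (ln (1 / (1 - (cmod z)\<^sup>2)) / (cmod z)\<^sup>2)"
proof -
  have lt: "(cmod z)\<^sup>2 < 1"
    using assms(1) by (simp add: abs_square_less_1)
  have zz: "z * cnj z = of_real ((cmod z)\<^sup>2)"
    using complex_norm_square[of z] by simp
  have "1 / (1 - z * cnj z) = of_real (1 / (1 - (cmod z)\<^sup>2))"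
    unfolding zz by simp
  then have "Ln (1 / (1 - z * cnj z)) = of_real (ln (1 / (1 - (cmod z)\<^sup>2)))"
    using lt Ln_of_real[of "1 / (1 - (cmod z)\<^sup>2)"] by simp
  then show ?thesis
    using assms(2) by (simp add: dirichlet_kernel_def zz)
qed

lemma dirichlet_kernel_diag_pos:
  assumes "cmod z < 1"
  shows "dirichlet_kernel z z \<in> \<real>" "Re (dirichlet_kernel z z) > 0"
proof -
  have lt: "(cmod z)\<^sup>2 < 1"
    using assms by (simp add: abs_square_less_1)
  have "z \<noteq> 0 \<Longrightarrow> 0 < ln (1 / (1 - (cmod z)\<^sup>2)) / (cmod z)\<^sup>2"
    using lt by (intro divide_pos_pos ln_gt_zero) auto
  then show "dirichlet_kernel z z \<in> \<real>" "Re (dirichlet_kernel z z) > 0"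
    using dirichlet_kernel_diag[OF assms]
    by (cases "z = 0"; simp add: dirichlet_kernel_def)+
qed

text \<open>The diagonal values of the kernel are positive reals, embedded in the complex numbers;
  \<open>Re\<close> only converts them to type \<^typ>\<open>real\<close>.\<close>

definition dirichlet_gram :: "(nat \<Rightarrow> complex) \<Rightarrow> nat \<Rightarrow> nat \<Rightarrow> complex" where
  "dirichlet_gram z n m = dirichlet_kernel (z n) (z m) /
     of_real (sqrt (Re (dirichlet_kernel (z n) (z n)) * Re (dirichlet_kernel (z m) (z m))))"

text \<open>A discrete measure, hence defined on all subsets of the plane; repeated points of the
  sequence are counted with multiplicity.\<close>

definition dirichlet_measure :: "(nat \<Rightarrow> complex) \<Rightarrow> complex measure" where
  "dirichlet_measure z = measure_of UNIV UNIV
     (\<lambda>A. \<Sum>n. ennreal (1 / Re (dirichlet_kernel (z n) (z n))) * indicator A (z n))"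

lemma space_dirichlet_measure [simp]: "space (dirichlet_measure z) = UNIV"
  by (simp add: dirichlet_measure_def space_measure_of_conv)

lemma sets_dirichlet_measure [simp]: "sets (dirichlet_measure z) = UNIV"
proof -
  have "sigma_sets UNIV UNIV = (UNIV :: complex set set)"
    by auto
  then show ?thesis
    by (simp add: dirichlet_measure_def sets_measure_of_conv)
qed

lemma emeasure_dirichlet_measure:
  "emeasure (dirichlet_measure z) A =
     (\<Sum>n. ennreal (1 / Re (dirichlet_kernel (z n) (z n))) * indicator A (z n))"
proof (rule emeasure_measure_of[OF dirichlet_measure_def])
  define w where "w n = ennreal (1 / Re (dirichlet_kernel (z n) (z n)))" for n
  show "countably_additive (sets (dirichlet_measure z))
    (\<lambda>A. \<Sum>n. ennreal (1 / Re (dirichlet_kernel (z n) (z n))) * indicator A (z n))"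
    unfolding countably_additive_def w_def[symmetric]
  proof (intro allI impI)
    fix A :: "nat \<Rightarrow> complex set"
    assume dA: "disjoint_family A"
    have "(\<Sum>i. \<Sum>n. w n * indicator (A i) (z n)) =
      (\<Sum>i. \<integral>\<^sup>+ n. w n * indicator (A i) (z n) \<partial>count_space UNIV)"
      by (simp add: nn_integral_count_space_nat)
    also have "\<dots> = (\<integral>\<^sup>+ n. (\<Sum>i. w n * indicator (A i) (z n)) \<partial>count_space UNIV)"
      by (rule nn_integral_suminf[symmetric]) simp
    also have "\<dots> = (\<Sum>n. \<Sum>i. w n * indicator (A i) (z n))"
      by (simp add: nn_integral_count_space_nat)
    also have "\<dots> = (\<Sum>n. w n * indicator (\<Union>i. A i) (z n))"
      by (simp add: suminf_indicator[OF dA, symmetric])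
    finally show "(\<Sum>i. \<Sum>n. w n * indicator (A i) (z n)) =
      (\<Sum>n. w n * indicator (\<Union> (range A)) (z n))" .
  qed
qed (auto simp: positive_def)

definition weakly_separated :: "(nat \<Rightarrow> complex) \<Rightarrow> bool" where
  "weakly_separated z \<longleftrightarrow>
     (SUP (n, m) \<in> {(n, m). n \<noteq> m}. ereal (cmod (dirichlet_gram z n m))) < 1"

section \<open>Arcs and Carleson boxes\<close>

text \<open>Arcs are the connected subsets of the circle, whether or not they contain their endpoints.\<close>

definition is_circle_arc :: "complex set \<Rightarrow> bool" where
  "is_circle_arc I \<longleftrightarrow> I \<subseteq> sphere 0 1 \<and> connected I"

definition arc_len :: "complex set \<Rightarrow> real" where
  "arc_len I = measure lebesgue {t \<in> {0..<1}. cis (2 * pi * t) \<in> I}"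

definition carleson_box :: "complex set \<Rightarrow> complex set" where
  "carleson_box I = {z \<in> ball 0 1 - {0}. z / of_real (cmod z) \<in> I \<and> 1 - cmod z \<le> arc_len I}"

text \<open>The closed arc with midpoint \<open>\<zeta>\<close> and normalized length \<open>l\<close>.\<close>

definition centred_arc :: "complex \<Rightarrow> real \<Rightarrow> complex set" where
  "centred_arc \<zeta> l = {\<zeta> * cis (2 * pi * t) | t. \<bar>t\<bar> \<le> l / 2}"

lemma is_circle_arc_centred_arc:
  assumes "cmod \<zeta> = 1"
  shows "is_circle_arc (centred_arc \<zeta> l)"
proof -
  have "{t. \<bar>t\<bar> \<le> l / 2} = {- (l / 2)..l / 2}"
    by auto
  then have eq: "centred_arc \<zeta> l = (\<lambda>t. \<zeta> * cis (2 * pi * t)) ` {- (l / 2)..l / 2}"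
    unfolding centred_arc_def by (auto simp: image_def set_eq_iff)
  have "connected (centred_arc \<zeta> l)"
    unfolding eq by (intro connected_continuous_image continuous_intros) auto
  then show ?thesis
    using assms by (auto simp: is_circle_arc_def eq norm_mult)
qed

lemma arc_len_centred_arc:
  assumes "cmod \<zeta> = 1" "0 \<le> l" "l \<le> 1"
  shows "arc_len (centred_arc \<zeta> l) = l"
proof -
  define \<phi> where "\<phi> = Arg \<zeta> / (2 * pi)"
  define b where "b = frac (\<phi> - l / 2)"
  have b: "0 \<le> b" "b < 1"
    by (simp_all add: b_def frac_ge_0 frac_lt_1)
  define k where "k = \<lfloor>\<phi> - l / 2\<rfloor>"
  have \<phi>: "\<phi> = b + l / 2 + of_int k"
    by (simp add: b_def k_def frac_def)
  have "\<zeta> \<noteq> 0"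
    using assms(1) by auto
  then have \<zeta>: "\<zeta> = cis (2 * pi * \<phi>)"
    using cis_Arg[of \<zeta>] assms(1) by (simp add: \<phi>_def sgn_div_norm)
  have cis_iff: "cis (2 * pi * s) = cis (2 * pi * t) \<longleftrightarrow> (\<exists>j::int. s = t + of_int j)" for s t
  proof -
    have "cis (2 * pi * s) = cis (2 * pi * t) \<longleftrightarrow>
        (\<exists>j::int. 2 * pi * s = 2 * pi * t + 2 * pi * of_int j)"
      using sin_cos_eq_iff[of "2 * pi * s" "2 * pi * t"] by (auto simp: complex_eq_iff)
    also have "\<dots> \<longleftrightarrow> (\<exists>j::int. s = t + of_int j)"
      by (simp add: distrib_left[symmetric] del: distrib_left)
    finally show ?thesis .
  qed
  have mem: "cis (2 * pi * t) \<in> centred_arc \<zeta> l \<longleftrightarrow> (\<exists>j::int. b \<le> t + j \<and> t + j \<le> b + l)" for t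
  proof -
    have "cis (2 * pi * t) \<in> centred_arc \<zeta> l \<longleftrightarrow>
        (\<exists>s. \<bar>s\<bar> \<le> l / 2 \<and> cis (2 * pi * t) = cis (2 * pi * (\<phi> + s)))"
      by (auto simp: centred_arc_def \<zeta> cis_mult distrib_left)
    also have "\<dots> \<longleftrightarrow> (\<exists>s. \<bar>s\<bar> \<le> l / 2 \<and> (\<exists>j::int. t = \<phi> + s + of_int j))"
      by (simp only: cis_iff)
    also have "\<dots> \<longleftrightarrow> (\<exists>j::int. b \<le> t + j \<and> t + j \<le> b + l)"
    proof safe
      fix s :: real and j :: int
      assume "\<bar>s\<bar> \<le> l / 2" "t = \<phi> + s + of_int j"
      then have "- (l / 2) \<le> s" "s \<le> l / 2"
        by linarith+
      then have "b \<le> \<phi> + s + of_int j + of_int (- k - j) \<and> \<phi> + s + of_int j + of_int (- k - j) \<le> b + l"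
        unfolding \<phi> of_int_diff of_int_minus by linarith
      then show "\<exists>i::int. b \<le> \<phi> + s + of_int j + of_int i \<and> \<phi> + s + of_int j + of_int i \<le> b + l"
        by blast
    next
      fix j :: int
      assume "b \<le> t + of_int j" "t + of_int j \<le> b + l"
      then have "\<bar>t + of_int j - b - l / 2\<bar> \<le> l / 2"
        "t = \<phi> + (t + of_int j - b - l / 2) + of_int (- k - j)"
        unfolding \<phi> of_int_diff of_int_minus by linarith+
      then show "\<exists>s. \<bar>s\<bar> \<le> l / 2 \<and> (\<exists>j::int. t = \<phi> + s + of_int j)"
        by blast
    qed
    finally show ?thesis .
  qed
  have mem': "cis (2 * pi * t) \<in> centred_arc \<zeta> l \<longleftrightarrow>
      b \<le> t \<and> t \<le> b + l \<or> t + 1 \<le> b + l" if t: "0 \<le> t" "t < 1" for t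
  proof -
    have "j = 0 \<or> j = 1" if j: "b \<le> t + of_int j" "t + of_int j \<le> b + l" for j :: int
    proof -
      have "of_int j > (-1 :: real)" "of_int j < (2 :: real)"
        using j t b assms by linarith+
      then show ?thesis
        by linarith
    qed
    moreover have "b \<le> t + 1"
      using b t by simp
    ultimately show ?thesis
      unfolding mem by (metis add.right_neutral of_int_0 of_int_1)
  qed
  have set_eq: "{t \<in> {0..<1}. cis (2 * pi * t) \<in> centred_arc \<zeta> l} =
      {t \<in> {0..<1}. b \<le> t \<and> t \<le> b + l \<or> t + 1 \<le> b + l}"
    using mem' by auto
  show ?thesis
  proof (cases "b + l < 1")
    case True
    then have "{t \<in> {0..<1}. b \<le> t \<and> t \<le> b + l \<or> t + 1 \<le> b + l} = {b..b + l}"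
      using b by auto
    then show ?thesis
      unfolding arc_len_def set_eq using assms by simp
  next
    case False
    show ?thesis
    proof (cases "l = 1")
      case True
      then have "{t \<in> {0..<1}. b \<le> t \<and> t \<le> b + l \<or> t + 1 \<le> b + l} = {0..<1}"
        using b by auto
      then show ?thesis
        unfolding arc_len_def set_eq using True by simp
    next
      case l: False
      have "{t \<in> {0..<1}. b \<le> t \<and> t \<le> b + l \<or> t + 1 \<le> b + l} = {b..<1} \<union> {0..b + l - 1}"
        using b l False assms by auto
      moreover have "measure lebesgue ({b..<1} \<union> {0..b + l - 1}) =
          measure lebesgue {b..<1} + measure lebesgue {0..b + l - 1}"
        using l assms b False by (intro measure_Union) auto
      ultimately show ?thesis
        unfolding arc_len_def set_eq using b False by simp
    qed
  qed
qed

section \<open>The conditions\<close>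

definition one_box :: "(nat \<Rightarrow> complex) \<Rightarrow> bool" where
  "one_box z \<longleftrightarrow> finite_measure (dirichlet_measure z) \<and>
     (\<exists>C>0. \<forall>I. is_circle_arc I \<and> 0 < arc_len I \<and> arc_len I < 1 \<longrightarrow>
        measure (dirichlet_measure z) (carleson_box I) \<le> C * inverse (ln (1 / arc_len I)))"

text \<open>Boundedness of the Gram matrix as an operator from \<open>\<ell>\<^sup>2\<close> to \<open>\<ell>\<^sup>\<infinity>\<close>.\<close>

definition column_bounded :: "(nat \<Rightarrow> complex) \<Rightarrow> bool" where
  "column_bounded z \<longleftrightarrow> (\<exists>C. \<forall>x :: nat \<Rightarrow> complex. summable (\<lambda>m. (cmod (x m))\<^sup>2) \<longrightarrow>
     (\<forall>n. summable (\<lambda>m. dirichlet_gram z n m * x m) \<and>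
          cmod (\<Sum>m. dirichlet_gram z n m * x m) \<le> C * sqrt (\<Sum>m. (cmod (x m))\<^sup>2)))"

lemma column_bounded_iff:
  "column_bounded z \<longleftrightarrow> (\<exists>C. \<forall>n. summable (\<lambda>m. (cmod (dirichlet_gram z n m))\<^sup>2) \<and>
     (\<Sum>m. (cmod (dirichlet_gram z n m))\<^sup>2) \<le> C)"
proof
  let ?g = "dirichlet_gram z"
  assume "column_bounded z"
  then obtain C where C: "cmod (\<Sum>m. ?g n m * x m) \<le> C * sqrt (\<Sum>m. (cmod (x m))\<^sup>2)"
    if "summable (\<lambda>m. (cmod (x m))\<^sup>2)" for n x
    unfolding column_bounded_def by blast
  have bd: "(\<Sum>m<N. (cmod (?g n m))\<^sup>2) \<le> C\<^sup>2" for n N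
  proof -
    define x where "x m = (if m < N then cnj (?g n m) else 0)" for m
    define S where "S = (\<Sum>m<N. (cmod (?g n m))\<^sup>2)"
    have "S \<ge> 0"
      by (simp add: S_def sum_nonneg)
    have "(\<lambda>m. (cmod (x m))\<^sup>2) sums (\<Sum>m<N. (cmod (x m))\<^sup>2)"
      by (rule sums_finite) (auto simp: x_def)
    then have x2: "(\<lambda>m. (cmod (x m))\<^sup>2) sums S"
      by (simp add: S_def x_def)
    have "(\<lambda>m. ?g n m * x m) sums (\<Sum>m<N. ?g n m * x m)"
      by (rule sums_finite) (auto simp: x_def)
    then have "(\<lambda>m. ?g n m * x m) sums of_real S"
      by (simp add: S_def x_def complex_norm_square[symmetric] del: of_real_power)
    then have "S \<le> C * sqrt S"
      using C[of x n] x2 \<open>S \<ge> 0\<close> by (simp add: sums_iff)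
    then have "sqrt S * sqrt S \<le> C * sqrt S"
      using \<open>S \<ge> 0\<close> by simp
    then have "S = 0 \<or> sqrt S \<le> C"
      using \<open>S \<ge> 0\<close> mult_le_cancel_right[of "sqrt S" "sqrt S" C] by auto
    then have "S \<le> C\<^sup>2"
      using \<open>S \<ge> 0\<close> sqrt_le_D by auto
    then show ?thesis
      by (simp add: S_def)
  qed
  have "summable (\<lambda>m. (cmod (?g n m))\<^sup>2)" for n
    using bd[of n] by (intro summableI_nonneg_bounded[where x = "C\<^sup>2"]) auto
  then show "\<exists>C. \<forall>n. summable (\<lambda>m. (cmod (?g n m))\<^sup>2) \<and> (\<Sum>m. (cmod (?g n m))\<^sup>2) \<le> C"
    using bd by (meson suminf_le_const)
next
  let ?g = "dirichlet_gram z"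
  assume "\<exists>C. \<forall>n. summable (\<lambda>m. (cmod (?g n m))\<^sup>2) \<and> (\<Sum>m. (cmod (?g n m))\<^sup>2) \<le> C"
  then obtain C where C: "summable (\<lambda>m. (cmod (?g n m))\<^sup>2)" "(\<Sum>m. (cmod (?g n m))\<^sup>2) \<le> C" for n
    by blast
  show "column_bounded z"
    unfolding column_bounded_def
  proof (intro exI[of _ "sqrt C"] allI impI)
    fix x :: "nat \<Rightarrow> complex" and n
    assume x: "summable (\<lambda>m. (cmod (x m))\<^sup>2)"
    let ?B = "sqrt C * sqrt (\<Sum>m. (cmod (x m))\<^sup>2)"
    have bd: "(\<Sum>m<N. cmod (?g n m * x m)) \<le> ?B" for N
    proof -
      have "(\<Sum>m<N. cmod (?g n m * x m)) \<le>
          L2_set (\<lambda>m. cmod (?g n m)) {..<N} * L2_set (\<lambda>m. cmod (x m)) {..<N}"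
        using L2_set_mult_ineq[of "\<lambda>m. cmod (?g n m)" "\<lambda>m. cmod (x m)" "{..<N}"]
        by (simp add: norm_mult)
      also have "\<dots> \<le> ?B"
        unfolding L2_set_def
        using C[of n] x
        by (intro mult_mono real_sqrt_le_mono order_trans[OF sum_le_suminf C(2)] sum_le_suminf)
          (auto intro: sum_nonneg suminf_nonneg order_trans[OF suminf_nonneg C(2)])
      finally show ?thesis .
    qed
    have s: "summable (\<lambda>m. cmod (?g n m * x m))"
      by (rule summableI_nonneg_bounded[where x = ?B]) (use bd in auto)
    have "cmod (\<Sum>m. ?g n m * x m) \<le> (\<Sum>m. cmod (?g n m * x m))"
      by (rule summable_norm[OF s])
    also have "\<dots> \<le> ?B"
      by (rule suminf_le_const[OF s bd])
    finally show "summable (\<lambda>m. ?g n m * x m) \<and> cmod (\<Sum>m. ?g n m * x m) \<le> ?B"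
      using summable_norm_cancel[OF s] by simp
  qed
qed

definition restricted_one_box :: "(nat \<Rightarrow> complex) \<Rightarrow> bool" where
  "restricted_one_box z \<longleftrightarrow> finite_measure (dirichlet_measure z) \<and>
     (\<exists>C>0. \<exists>\<delta>. 0 < \<delta> \<and> \<delta> < 1 \<and> (\<forall>n. z n \<noteq> 0 \<longrightarrow>
        measure (dirichlet_measure z)
          (carleson_box (centred_arc (z n / of_real (cmod (z n))) ((1 - cmod (z n)) powr \<delta>)))
        \<le> C * inverse (ln (1 / (1 - cmod (z n))))))"

end

theory Submission
  imports Defs "HOL-Library.Log_Nat"
begin

text \<open>
Up to additive and multiplicative constants the kernel is the proximity
\<open>L(z, w) = ln (1 / cmod (1 - z * cnj w))\<close> (\<open>kernel_norm_ge_log_nearness\<close> and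
\<open>kernel_norm_le_log_nearness\<close>), its diagonal value \<open>d(z)\<close> is the depth \<open>ln (1 / (1 - cmod z))\<close>, and
the Carleson box over an arc of length \<open>exp (- s)\<close> centred at \<open>z\<close> is the set \<open>{L(z, \<cdot>) > s}\<close>
(\<open>carleson_box_nearness\<close> and \<open>nearness_carleson_box\<close>). All three conditions are therefore
statements about the masses \<open>\<mu>(L(z, \<cdot>) > s)\<close>. The one box condition bounds them by \<open>C / s\<close>, for
every centre and all \<open>s\<close>. Column boundedness is \<open>\<integral> L(z, \<cdot>)\<^sup>2 d\<mu> \<le> C * d(z)\<close>, with \<open>z\<close> a term of
the sequence; and the restricted one box condition bounds the mass by \<open>C / d(z)\<close> at the single
level \<open>s = \<delta> * d(z)\<close>.

Since \<open>L(z, \<cdot>)\<close> is at most about \<open>d(z)\<close>, summation over level sets turns the tail bound \<open>C / s\<close> into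
\<open>\<integral> 2 s * (C / s) ds\<close> over \<open>0 < s < d(z)\<close>, which is of order \<open>d(z)\<close>
(\<open>one_box_imp_column_bounded\<close>). Restricting the column sum to the box, where \<open>L(z, \<cdot>)\<close> is at
least of order \<open>\<delta> * d(z)\<close>, gives \<open>\<delta>\<^sup>2 * d(z)\<^sup>2 * \<mu>(box) \<le> C * d(z)\<close> up to constants
(\<open>column_bounded_imp_restricted_one_box\<close>).

Both counterexamples consist of clusters. Cluster \<open>k\<close> has \<open>N\<close> points of common depth \<open>D\<close> with
mutual proximity about \<open>s\<close>, and different clusters lie around angles \<open>1 / 2 ^ k\<close> so that they
hardly interact. The cluster has mass \<open>N / D\<close> in a box of size \<open>exp (- s)\<close>, so the one box condition
requires \<open>N * s / D\<close> to be bounded. The column sum of a point of the cluster is about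
\<open>1 + N * s\<^sup>2 / D\<^sup>2\<close>. If \<open>s\<close> is a small proportion of \<open>D\<close>, the sequence is weakly separated and each
restricted box contains a single point. With \<open>N\<close> of order \<open>4 ^ k\<close> and \<open>D\<close> of order \<open>16 ^ k\<close> it
remains to choose \<open>s\<close>: of order \<open>8 ^ k\<close>, the column sums are bounded but \<open>N * s / D\<close> is of order
\<open>2 ^ k\<close>; of order \<open>16 ^ k\<close>, that is, proportional to \<open>D\<close>, the column sums are of order \<open>4 ^ k\<close>.
\<close>

section \<open>The kernel and the logarithmic proximity of two points\<close>

text \<open>The logarithmic proximity of two points of the disc. It is the real part of
\<open>Ln (1 / (1 - z * cnj w))\<close>, and it measures how many generations of the dyadic tree of
Carleson boxes the two points share: it equals the depth \<open>ln (1 / (1 - cmod z))\<close> up to a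
constant when \<open>w = z\<close>, and it is bounded when the points are far apart.\<close>

definition log_nearness :: "complex \<Rightarrow> complex \<Rightarrow> real" where
  "log_nearness z w = ln (1 / cmod (1 - z * cnj w))"

lemma norm_mult_cnj_less_1:
  assumes "cmod z < 1" "cmod w < 1"
  shows "cmod (z * cnj w) < 1"
  using assms mult_strict_mono'[of "cmod z" 1 "cmod w" 1] by (simp add: norm_mult)

lemma one_minus_norm_le_norm_one_minus_mult_cnj:
  assumes "cmod w \<le> 1"
  shows "1 - cmod z \<le> cmod (1 - z * cnj w)"
proof -
  have "cmod z * cmod w \<le> cmod z"
    using assms by (simp add: mult_left_le)
  then show ?thesis
    using norm_triangle_ineq2[of 1 "z * cnj w"] by (simp add: norm_mult)
qed

lemma log_nearness_le_depth:
  assumes "cmod z < 1" "cmod w < 1"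
  shows "log_nearness z w \<le> ln (1 / (1 - cmod z))"
proof -
  have "1 - cmod z \<le> cmod (1 - z * cnj w)" "0 < 1 - cmod z"
    using assms one_minus_norm_le_norm_one_minus_mult_cnj[of w z] by auto
  then show ?thesis
    by (simp add: log_nearness_def ln_div)
qed

lemma depth_le_log_nearness_self:
  assumes "cmod z < 1"
  shows "ln (1 / (1 - cmod z)) - ln 2 \<le> log_nearness z z"
proof -
  have sq: "1 - z * cnj z = of_real (1 - (cmod z)\<^sup>2)"
    by (simp only: complex_norm_square of_real_diff of_real_1)
  have fac: "1 - (cmod z)\<^sup>2 = (1 - cmod z) * (1 + cmod z)"
    by (simp add: power2_eq_square algebra_simps)
  have "cmod (1 - z * cnj z) = (1 - cmod z) * (1 + cmod z)"
    unfolding sq norm_of_real fac using assms by (simp add: abs_mult)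
  then have "log_nearness z z = ln (1 / (1 - cmod z)) - ln (1 + cmod z)"
    using assms norm_ge_zero[of z]
    by (simp add: log_nearness_def ln_div ln_mult add_nonneg_eq_0_iff)
  moreover have "ln (1 + cmod z) \<le> ln 2"
    using assms by (simp add: add_pos_nonneg)
  ultimately show ?thesis
    by simp
qed

text \<open>The mean value inequality for \<open>exp\<close> on the half-plane \<open>Re w \<le> ln 2\<close>, where the derivative is at
most \<open>2\<close> in modulus. It bounds the logarithm from below and so keeps the kernel away from zero.\<close>

lemma norm_minus_one_le_Ln:
  assumes "v \<noteq> 0" "cmod v \<le> 2"
  shows "cmod (v - 1) \<le> 2 * cmod (Ln v)"
proof -
  have "cmod (exp (Ln v) - exp 0) \<le> 2 * cmod (Ln v - 0)"
  proof (rule field_differentiable_bound[where S = "{w. Re w \<le> ln 2}"])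
    show "convex {w. Re w \<le> ln 2}"
      by (rule convex_halfspace_Re_le)
    show "(exp has_field_derivative exp w) (at w within {w. Re w \<le> ln 2})" for w :: complex
      by (rule DERIV_subset[OF DERIV_exp]) simp
    fix w :: complex assume "w \<in> {w. Re w \<le> ln 2}"
    then have "exp (Re w) \<le> exp (ln 2)"
      by (simp only: exp_le_cancel_iff mem_Collect_eq)
    then show "cmod (exp w) \<le> 2"
      by simp
  next
    show "Ln v \<in> {w. Re w \<le> ln 2}"
      using assms by simp
  qed simp
  then show ?thesis
    using assms by simp
qed

lemma norm_dirichlet_kernel:
  assumes "cmod z < 1" "cmod w < 1" "z * cnj w \<noteq> 0"
  shows "cmod (dirichlet_kernel z w) = cmod (Ln (1 - z * cnj w)) / cmod (z * cnj w)"
proof -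
  have "Re (z * cnj w) < 1"
    using norm_mult_cnj_less_1[OF assms(1,2)] complex_Re_le_cmod[of "z * cnj w"] by simp
  then have "1 - z * cnj w \<notin> \<real>\<^sub>\<le>\<^sub>0"
    by (auto simp: complex_nonpos_Reals_iff)
  then have "Ln (1 / (1 - z * cnj w)) = - Ln (1 - z * cnj w)"
    by (simp add: Ln_inverse inverse_eq_divide[symmetric])
  then show ?thesis
    using assms(3) by (simp add: dirichlet_kernel_def norm_divide norm_mult)
qed

text \<open>The kernel has no zeros, and stays away from zero: this is what makes column boundedness control
the total mass of the associated measure.\<close>

lemma kernel_norm_ge_half:
  assumes "cmod z < 1" "cmod w < 1"
  shows "1 / 2 \<le> cmod (dirichlet_kernel z w)"
proof (cases "z * cnj w = 0")
  case False
  define u where "u = z * cnj w"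
  have u: "u \<noteq> 0" "cmod u < 1"
    using False norm_mult_cnj_less_1[OF assms] by (auto simp: u_def)
  have u1: "u \<noteq> 1"
    using u by auto
  have "cmod (1 - u) \<le> 2"
    using u norm_triangle_ineq4[of 1 u] by simp
  then have "cmod u \<le> 2 * cmod (Ln (1 - u))"
    using norm_minus_one_le_Ln[of "1 - u"] u1 by simp
  moreover have "cmod (dirichlet_kernel z w) = cmod (Ln (1 - u)) / cmod u"
    unfolding u_def by (rule norm_dirichlet_kernel[OF assms False])
  ultimately have "1 / 2 * cmod u \<le> cmod (dirichlet_kernel z w) * cmod u"
    using u by simp
  moreover have "cmod u > 0"
    using u by simp
  ultimately show ?thesis
    by (rule mult_right_le_imp_le)
qed (simp add: dirichlet_kernel_def)

lemma kernel_norm_ge_log_nearness: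
  assumes "cmod z < 1" "cmod w < 1"
  shows "log_nearness z w \<le> cmod (dirichlet_kernel z w)"
proof (cases "z * cnj w = 0")
  case True
  then show ?thesis
    by (auto simp: dirichlet_kernel_def log_nearness_def)
next
  case False
  define u where "u = z * cnj w"
  have u: "u \<noteq> 0" "cmod u < 1"
    using False norm_mult_cnj_less_1[OF assms] by (auto simp: u_def)
  have u1: "u \<noteq> 1"
    using u by auto
  have "log_nearness z w = - Re (Ln (1 - u))"
    using u1 by (simp add: log_nearness_def u_def ln_div)
  also have "\<dots> \<le> cmod (Ln (1 - u))"
    using abs_Re_le_cmod[of "Ln (1 - u)"] by linarith
  also have "\<dots> \<le> cmod (Ln (1 - u)) / cmod u"
    using u divide_left_mono[of "cmod u" 1 "cmod (Ln (1 - u))"] by simp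
  finally show ?thesis
    unfolding u_def norm_dirichlet_kernel[OF assms False] .
qed

lemma log_nearness_ge:
  assumes "cmod z < 1" "cmod w < 1"
  shows "- 1 \<le> log_nearness z w"
proof -
  have u: "cmod (z * cnj w) < 1"
    by (rule norm_mult_cnj_less_1[OF assms])
  have le: "cmod (1 - z * cnj w) \<le> 2"
    using u norm_triangle_ineq4[of 1 "z * cnj w"] by simp
  have "z * cnj w \<noteq> 1"
    using u by auto
  then have pos: "cmod (1 - z * cnj w) > 0"
    by simp
  have "ln (cmod (1 - z * cnj w)) \<le> ln 2"
    using le pos by simp
  moreover have "log_nearness z w = - ln (cmod (1 - z * cnj w))"
    using pos by (simp add: log_nearness_def ln_div)
  ultimately show ?thesis
    using ln_2_less_1 by linarith
qed

text \<open>Up to constants the kernel is its own logarithmic singularity. For small \<open>u = z * cnj w\<close> the quotient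
\<open>Ln (1 - u) / u\<close> is bounded, and otherwise dividing by \<open>u\<close> costs at most a factor \<open>2\<close>, while the
imaginary part of the logarithm is at most \<open>pi / 2\<close> because \<open>1 - u\<close> lies in the right half-plane.\<close>

lemma kernel_norm_le_log_nearness:
  assumes "cmod z < 1" "cmod w < 1"
  shows "cmod (dirichlet_kernel z w) \<le> 2 * log_nearness z w + 8"
proof (cases "z * cnj w = 0")
  case True
  then show ?thesis
    by (auto simp: dirichlet_kernel_def log_nearness_def)
next
  case False
  define u where "u = z * cnj w"
  have u: "u \<noteq> 0" "cmod u < 1"
    using False norm_mult_cnj_less_1[OF assms] by (auto simp: u_def)
  have u1: "u \<noteq> 1"
    using u by auto
  have Re_pos: "Re (1 - u) > 0"
    using u complex_Re_le_cmod[of u] by simp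
  have K: "cmod (dirichlet_kernel z w) = cmod (Ln (1 - u)) / cmod u"
    unfolding u_def by (rule norm_dirichlet_kernel[OF assms False])
  have ge: "- 1 \<le> log_nearness z w"
    by (rule log_nearness_ge[OF assms])
  show ?thesis
  proof (cases "cmod u < 1 / 2")
    case True
    then have "cmod (Ln (1 - u)) \<le> 2 * cmod u"
      using norm_Ln_le[of "- u"] by simp
    then have "cmod (dirichlet_kernel z w) \<le> 2"
      using u by (simp add: K field_simps)
    then show ?thesis
      using ge by simp
  next
    case False
    have "cmod (Ln (1 - u)) \<le> \<bar>Re (Ln (1 - u))\<bar> + \<bar>Im (Ln (1 - u))\<bar>"
      by (rule cmod_le)
    also have "\<bar>Im (Ln (1 - u))\<bar> \<le> 2"
      using Re_Ln_pos_lt_imp[OF Re_pos] pi_less_4 by simp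
    also have "Re (Ln (1 - u)) = - log_nearness z w"
      using u1 by (simp add: log_nearness_def u_def ln_div)
    also have "\<bar>- log_nearness z w\<bar> \<le> log_nearness z w + 2"
      using ge by simp
    finally have Ln_le: "cmod (Ln (1 - u)) \<le> log_nearness z w + 4"
      by simp
    have "cmod (dirichlet_kernel z w) \<le> cmod (Ln (1 - u)) / (1 / 2)"
      unfolding K by (rule divide_left_mono) (use False u in auto)
    then show ?thesis
      using Ln_le by simp
  qed
qed

text \<open>An angle is controlled by the distance to \<open>1\<close>: near \<open>1\<close> because the angle is the imaginary part of
the logarithm, and away from \<open>1\<close> because every argument is at most \<open>pi < 4\<close>.\<close>

lemma abs_Arg_le:
  assumes "u \<noteq> 0"
  shows "\<bar>Arg u\<bar> \<le> 8 * cmod (1 - u)"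
proof (cases "cmod (1 - u) < 1 / 2")
  case True
  have "\<bar>Arg u\<bar> \<le> cmod (Ln u)"
    using assms abs_Im_le_cmod[of "Ln u"] by (simp add: Arg_eq_Im_Ln)
  also have "\<dots> \<le> 2 * cmod (u - 1)"
    using norm_Ln_le[of "u - 1"] True by (simp add: norm_minus_commute)
  finally show ?thesis
    using norm_ge_zero[of "1 - u"] by (simp add: norm_minus_commute)
next
  case False
  then show ?thesis
    using Arg_bounded[of u] pi_less_4 by auto
qed

lemma norm_cis_minus_one_le: "cmod (cis x - 1) \<le> \<bar>x\<bar>"
proof -
  have "cmod (cis x - cis 0) \<le> 1 * norm (x - 0)"
    by (rule differentiable_bound[where S = UNIV and f' = "\<lambda>t h. h *\<^sub>R (\<i> * cis t)"])
       (auto intro!: onorm_le derivative_eq_intros simp: norm_mult)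
  then show ?thesis
    by simp
qed

lemma norm_one_minus_polar_le:
  assumes "0 \<le> q" "q \<le> 1"
  shows "cmod (1 - of_real q * cis x) \<le> (1 - q) + \<bar>x\<bar>"
proof -
  have "1 - of_real q * cis x = of_real (1 - q) - of_real q * (cis x - 1)"
    by (simp add: algebra_simps)
  then have "cmod (1 - of_real q * cis x) \<le>
      cmod (of_real (1 - q)) + cmod (of_real q * (cis x - 1))"
    using norm_triangle_ineq4 by metis
  also have "\<dots> \<le> (1 - q) + 1 * \<bar>x\<bar>"
    using assms norm_cis_minus_one_le[of x] mult_mono[of q 1 "cmod (cis x - 1)" "\<bar>x\<bar>"]
    by (simp only: norm_of_real norm_mult) simp
  finally show ?thesis
    by simp
qed

section \<open>Carleson boxes as level sets of the proximity\<close>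

text \<open>Carleson boxes and level sets of \<open>cmod (1 - z * cnj w)\<close> are the same thing up to constants. A point
of the box over an arc centred at \<open>z\<close> differs from \<open>z\<close> by an angle at most \<open>pi * l\<close> and both
points are within \<open>l\<close> of the circle.\<close>

lemma carleson_box_nearness:
  assumes "cmod z < 1" "z \<noteq> 0" "0 \<le> l" "l \<le> 1" "1 - cmod z \<le> l"
    and w: "w \<in> carleson_box (centred_arc (z / of_real (cmod z)) l)"
  shows "cmod (1 - z * cnj w) \<le> 6 * l"
proof -
  define \<zeta> where "\<zeta> = z / of_real (cmod z)"
  have \<zeta>1: "cmod \<zeta> = 1"
    using assms by (simp add: \<zeta>_def norm_divide)
  have w0: "w \<noteq> 0" "cmod w < 1"
    using w by (auto simp: carleson_box_def)
  have "w / of_real (cmod w) \<in> centred_arc \<zeta> l" and wl: "1 - cmod w \<le> l"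
    using w arc_len_centred_arc[OF \<zeta>1, of l] assms by (auto simp: carleson_box_def \<zeta>_def)
  then obtain t where t: "w / of_real (cmod w) = \<zeta> * cis (2 * pi * t)" "\<bar>t\<bar> \<le> l / 2"
    by (auto simp: centred_arc_def)
  define x where "x = 2 * pi * t"
  have x: "\<bar>x\<bar> \<le> 4 * l"
  proof -
    have "\<bar>x\<bar> = 2 * pi * \<bar>t\<bar>"
      by (simp add: x_def abs_mult)
    also have "\<dots> \<le> 2 * 4 * (l / 2)"
      using t(2) pi_less_4 by (intro mult_mono) auto
    finally show ?thesis
      by simp
  qed
  have weq: "w = of_real (cmod w) * (\<zeta> * cis x)"
    using t(1) w0 by (simp add: x_def field_simps)
  have zeq: "z = of_real (cmod z) * \<zeta>"
    using assms by (simp add: \<zeta>_def)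
  have \<zeta>\<zeta>: "\<zeta> * cnj \<zeta> = 1"
    using \<zeta>1 complex_norm_square[of \<zeta>] by simp
  define q where "q = cmod z * cmod w"
  have "z * cnj w = of_real (cmod z) * \<zeta> * cnj (of_real (cmod w) * (\<zeta> * cis x))"
    using weq zeq by metis
  also have "\<dots> = of_real q * (\<zeta> * cnj \<zeta>) * cis (- x)"
    by (simp add: q_def cis_cnj)
  finally have zw: "z * cnj w = of_real q * cis (- x)"
    by (simp add: \<zeta>\<zeta>)
  have q: "0 \<le> q" "q \<le> 1" "1 - q \<le> 2 * l"
  proof -
    have "q \<ge> (1 - l) * (1 - l)"
      unfolding q_def using assms wl by (intro mult_mono) auto
    moreover have "(1 - l) * (1 - l) \<ge> 1 - 2 * l"
      using zero_le_square[of l] by (simp add: algebra_simps)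
    ultimately show "1 - q \<le> 2 * l"
      by simp
    show "0 \<le> q" "q \<le> 1"
      using assms w0 by (auto simp: q_def mult_le_one)
  qed
  show ?thesis
    using norm_one_minus_polar_le[OF q(1,2), of "- x"] q(3) x unfolding zw by simp
qed

text \<open>The converse inclusion: when \<open>z * cnj w\<close> is within \<open>t\<close> of \<open>1\<close>, its argument, which is the angle
between the two points, is at most \<open>8 * t\<close>, and the arc of length \<open>4 * t\<close> reaches out to the angle
\<open>4 * pi * t\<close> on either side.\<close>

lemma nearness_carleson_box:
  assumes "cmod z < 1" "cmod w < 1" "cmod (1 - z * cnj w) < t" "t \<le> 1 / 4"
  shows "z \<noteq> 0" "w \<in> carleson_box (centred_arc (z / of_real (cmod z)) (4 * t))"
proof -
  have ne: "z \<noteq> 0" "w \<noteq> 0"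
    using assms by auto
  then show "z \<noteq> 0"
    by simp
  have tpos: "t > 0"
    using assms(3) norm_ge_zero[of "1 - z * cnj w"] by linarith
  define \<zeta> where "\<zeta> = z / of_real (cmod z)"
  have \<zeta>1: "cmod \<zeta> = 1"
    using ne by (simp add: \<zeta>_def norm_divide)
  have "1 - cmod w \<le> cmod (1 - w * cnj z)"
    using assms by (intro one_minus_norm_le_norm_one_minus_mult_cnj) simp
  also have "\<dots> = cmod (1 - z * cnj w)"
    by (metis complex_cnj_cnj complex_cnj_diff complex_cnj_mult complex_cnj_one complex_mod_cnj mult.commute)
  finally have depth: "1 - cmod w \<le> 4 * t"
    using assms tpos by simp
  define x where "x = Arg (z * cnj w)"
  have x: "\<bar>x\<bar> \<le> 8 * t"
    using abs_Arg_le[of "z * cnj w"] ne assms(3) by (simp add: x_def)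
  have "cis x = z * cnj w / of_real (cmod (z * cnj w))"
    using cis_Arg[of "z * cnj w"] ne by (simp add: x_def sgn_div_norm scaleR_conv_of_real field_simps)
  then have "cis (- x) = cnj z * w / of_real (cmod z * cmod w)"
    by (simp add: cis_cnj[symmetric] norm_mult)
  moreover have "z * cnj z = of_real (cmod z) * of_real (cmod z)"
    using complex_norm_square[of z] by (simp add: power2_eq_square)
  ultimately have "\<zeta> * cis (- x) = (of_real (cmod z) * of_real (cmod z)) * w
      / (of_real (cmod z) * (of_real (cmod z) * of_real (cmod w)))"
    unfolding \<zeta>_def by (simp flip: mult.assoc)
  then have "w / of_real (cmod w) = \<zeta> * cis (- x)"
    using ne by simp
  moreover have "- x = 2 * pi * (- x / (2 * pi))"
    by simp
  moreover have "\<bar>- x / (2 * pi)\<bar> \<le> 4 * t / 2"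
  proof -
    have "\<bar>x\<bar> \<le> (4 * t) * pi"
      using x pi_ge_two mult_left_mono[of 2 pi "4 * t"] tpos by linarith
    then show ?thesis
      by (simp add: abs_divide field_simps)
  qed
  ultimately have "w / of_real (cmod w) \<in> centred_arc \<zeta> (4 * t)"
    unfolding centred_arc_def by (metis (mono_tags, lifting) mem_Collect_eq)
  then show "w \<in> carleson_box (centred_arc (z / of_real (cmod z)) (4 * t))"
    using arc_len_centred_arc[OF \<zeta>1, of "4 * t"] assms ne tpos depth
    by (simp add: carleson_box_def \<zeta>_def)
qed

section \<open>The weights and the Gram matrix\<close>

definition kernel_diag :: "complex \<Rightarrow> real" where
  "kernel_diag w = Re (dirichlet_kernel w w)"

lemma kernel_diag_eq_norm:
  assumes "cmod w < 1"
  shows "kernel_diag w = cmod (dirichlet_kernel w w)"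
  using dirichlet_kernel_diag_pos[OF assms]
  by (metis Reals_cases Re_complex_of_real abs_of_pos kernel_diag_def norm_of_real)

lemma kernel_diag_ge_half:
  assumes "cmod w < 1"
  shows "1 / 2 \<le> kernel_diag w"
  using kernel_norm_ge_half[OF assms assms] kernel_diag_eq_norm[OF assms] by simp

lemma kernel_diag_ge_depth:
  assumes "cmod w < 1"
  shows "ln (1 / (1 - cmod w)) - 1 \<le> kernel_diag w"
  using depth_le_log_nearness_self[OF assms] kernel_norm_ge_log_nearness[OF assms assms]
    kernel_diag_eq_norm[OF assms] ln_2_less_1 by linarith

lemma kernel_diag_le_depth:
  assumes "cmod w < 1"
  shows "kernel_diag w \<le> 2 * ln (1 / (1 - cmod w)) + 8"
  using log_nearness_le_depth[OF assms assms] kernel_norm_le_log_nearness[OF assms assms]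
    kernel_diag_eq_norm[OF assms] by linarith

lemma norm_gram_squared:
  assumes "cmod (z n) < 1" "cmod (z m) < 1"
  shows "(cmod (dirichlet_gram z n m))\<^sup>2 =
    (cmod (dirichlet_kernel (z n) (z m)))\<^sup>2 / (kernel_diag (z n) * kernel_diag (z m))"
  using kernel_diag_ge_half[OF assms(1)] kernel_diag_ge_half[OF assms(2)]
  by (simp add: dirichlet_gram_def norm_divide power_divide kernel_diag_def[symmetric]
      power_mult_distrib)

lemma column_boundedI:
  assumes "\<And>n N. (\<Sum>m<N. (cmod (dirichlet_gram z n m))\<^sup>2) \<le> C"
  shows "column_bounded z"
  unfolding column_bounded_iff
proof (intro exI[of _ C] allI conjI)
  fix n
  show "summable (\<lambda>m. (cmod (dirichlet_gram z n m))\<^sup>2)"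
    by (rule summableI_nonneg_bounded[where x = C]) (use assms in auto)
  then show "(\<Sum>m. (cmod (dirichlet_gram z n m))\<^sup>2) \<le> C"
    by (rule suminf_le_const) (rule assms)
qed

lemma column_boundedD:
  assumes "column_bounded z"
  obtains C where "\<And>n F. finite F \<Longrightarrow> (\<Sum>m\<in>F. (cmod (dirichlet_gram z n m))\<^sup>2) \<le> C"
proof -
  obtain C where C: "\<And>n. summable (\<lambda>m. (cmod (dirichlet_gram z n m))\<^sup>2)"
    "\<And>n. (\<Sum>m. (cmod (dirichlet_gram z n m))\<^sup>2) \<le> C"
    using assms unfolding column_bounded_iff by blast
  show thesis
  proof (rule that)
    fix n and F :: "nat set" assume "finite F"
    then show "(\<Sum>m\<in>F. (cmod (dirichlet_gram z n m))\<^sup>2) \<le> C"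
      by (intro order_trans[OF sum_le_suminf C(2)] C(1)) auto
  qed
qed

section \<open>Masses of the associated measure as finite sums of weights\<close>

lemma emeasure_dirichlet_measure_eq_suminf:
  "emeasure (dirichlet_measure z) A = (\<Sum>n. ennreal (1 / kernel_diag (z n) * indicator A (z n)))"
  unfolding emeasure_dirichlet_measure kernel_diag_def
  by (rule suminf_cong) (simp split: split_indicator)

lemma finite_dirichlet_measureI:
  assumes "range z \<subseteq> ball 0 1" "summable (\<lambda>n. 1 / kernel_diag (z n))"
  shows "finite_measure (dirichlet_measure z)"
proof (rule finite_measureI)
  have "0 \<le> 1 / kernel_diag (z n)" for n
    using kernel_diag_ge_half[of "z n"] assms(1) by (auto simp: image_subset_iff)
  then show "emeasure (dirichlet_measure z) (space (dirichlet_measure z)) \<noteq> \<infinity>"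
    using assms(2) by (simp add: emeasure_dirichlet_measure_eq_suminf suminf_ennreal2)
qed

lemma sum_le_measure_dirichlet:
  assumes "range z \<subseteq> ball 0 1" "finite_measure (dirichlet_measure z)" "finite F"
    and "\<And>m. m \<in> F \<Longrightarrow> z m \<in> A"
  shows "(\<Sum>m\<in>F. 1 / kernel_diag (z m)) \<le> measure (dirichlet_measure z) A"
proof -
  interpret finite_measure "dirichlet_measure z"
    by fact
  have nonneg: "0 \<le> 1 / kernel_diag (z m)" for m
    using kernel_diag_ge_half[of "z m"] assms(1) by (auto simp: image_subset_iff)
  have "ennreal (\<Sum>m\<in>F. 1 / kernel_diag (z m)) =
      (\<Sum>m\<in>F. ennreal (1 / kernel_diag (z m) * indicator A (z m)))"
    using assms(4) nonneg by (simp add: sum_ennreal[symmetric] del: sum_ennreal)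
  also have "\<dots> \<le> emeasure (dirichlet_measure z) A"
    unfolding emeasure_dirichlet_measure_eq_suminf by (intro sum_le_suminf assms) auto
  finally show ?thesis
    unfolding emeasure_eq_measure by simp
qed

lemma measure_dirichlet_le:
  assumes "range z \<subseteq> ball 0 1" "0 \<le> B"
    and "\<And>F. finite F \<Longrightarrow> z ` F \<subseteq> A \<Longrightarrow> (\<Sum>m\<in>F. 1 / kernel_diag (z m)) \<le> B"
  shows "measure (dirichlet_measure z) A \<le> B"
proof -
  have nonneg: "0 \<le> 1 / kernel_diag (z m)" for m
    using kernel_diag_ge_half[of "z m"] assms(1) by (auto simp: image_subset_iff)
  have "(\<Sum>m<N. ennreal (1 / kernel_diag (z m) * indicator A (z m))) \<le> ennreal B" for N
  proof -
    have "(\<Sum>m<N. 1 / kernel_diag (z m) * indicator A (z m)) =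
        (\<Sum>m\<in>{m\<in>{..<N}. z m \<in> A}. 1 / kernel_diag (z m))"
      by (subst sum.inter_filter) (auto intro!: sum.cong)
    also have "\<dots> \<le> B"
      by (rule assms(3)) auto
    finally show ?thesis
      using nonneg by (subst sum_ennreal) (auto intro!: ennreal_leI mult_nonneg_nonneg)
  qed
  then have "emeasure (dirichlet_measure z) A \<le> ennreal B"
    unfolding emeasure_dirichlet_measure_eq_suminf by (intro suminf_le_const) auto
  then show ?thesis
    unfolding measure_def using assms(2) enn2real_leI by blast
qed

section \<open>One box implies column bounded\<close>

text \<open>The square of an integer is a sum of odd numbers. This is the discrete form of
\<open>x\<^sup>2 = \<integral> 2 s ds\<close> over \<open>0 < s < x\<close>, used to write a sum of squared logarithms as a sum over
its level sets.\<close>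

lemma square_nat_ceiling_le_sum:
  assumes "nat \<lceil>x\<rceil> \<le> P"
  shows "(real (nat \<lceil>x\<rceil>))\<^sup>2 \<le> (\<Sum>k<P. (2 * real k + 1) * of_bool (real k < x))"
proof -
  have odd: "(\<Sum>k<l. 2 * real k + 1) = (real l)\<^sup>2" for l
    by (induction l) (auto simp: power2_eq_square algebra_simps)
  have "(real (nat \<lceil>x\<rceil>))\<^sup>2 = (\<Sum>k<nat \<lceil>x\<rceil>. (2 * real k + 1) * of_bool (real k < x))"
    unfolding odd[symmetric] by (intro sum.cong refl) (auto, linarith)
  also have "\<dots> \<le> (\<Sum>k<P. (2 * real k + 1) * of_bool (real k < x))"
    using assms by (intro sum_mono2) auto
  finally show ?thesis .
qed

text \<open>The one box condition says that the level set \<open>{log_nearness (z n) > k}\<close>, being contained in the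
box of an arc of length \<open>4 * exp (- k)\<close>, has mass at most of order \<open>1 / k\<close>. For \<open>k < 3\<close>, where such an arc
may be too long or the logarithm of its length too small, the total mass serves as the bound.\<close>

lemma one_box_tail:
  assumes "range z \<subseteq> ball 0 1" "finite_measure (dirichlet_measure z)" "C > 0"
    and C: "\<And>I. is_circle_arc I \<Longrightarrow> 0 < arc_len I \<Longrightarrow> arc_len I < 1 \<Longrightarrow>
        measure (dirichlet_measure z) (carleson_box I) \<le> C * inverse (ln (1 / arc_len I))"
    and "finite F" "\<And>m. m \<in> F \<Longrightarrow> real k < log_nearness (z n) (z m)"
  shows "(\<Sum>m\<in>F. 1 / kernel_diag (z m)) \<le>
    (3 * measure (dirichlet_measure z) UNIV + 4 * C) / (real k + 1)"
proof -
  define T where "T = measure (dirichlet_measure z) UNIV"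
  have T: "0 \<le> T"
    by (simp add: T_def)
  have disc: "cmod (z m) < 1" for m
    using assms(1) by (auto simp: image_subset_iff)
  show ?thesis
  proof (cases "k < 3")
    case True
    have "(\<Sum>m\<in>F. 1 / kernel_diag (z m)) \<le> T"
      unfolding T_def by (rule sum_le_measure_dirichlet) (use assms in auto)
    also have "T * (real k + 1) \<le> T * 3"
      using T True by (intro mult_left_mono) auto
    then have "T \<le> (3 * T + 4 * C) / (real k + 1)"
      using assms(3) by (simp add: field_simps)
    finally show ?thesis
      by (simp add: T_def)
  next
    case False
    define t where "t = exp (- real k)"
    have t0: "0 < t"
      by (simp add: t_def)
    have t4: "t < 1 / 4"
    proof -
      have "ln 4 < real k"
        using False ln_2_less_1 ln_realpow[of 2 2] by simp
      then have "exp (- real k) < exp (- ln 4)"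
        by (simp only: exp_less_mono neg_less_iff_less)
      then show ?thesis
        by (simp add: t_def exp_minus)
    qed
    have near: "cmod (1 - z n * cnj (z m)) < t" if "m \<in> F" for m
    proof -
      have "cmod (1 - z n * cnj (z m)) > 0"
        using norm_mult_cnj_less_1[OF disc disc, of n m] by auto
      moreover have "real k < log_nearness (z n) (z m)"
        using assms(6) that by simp
      ultimately have "ln (cmod (1 - z n * cnj (z m))) < - real k"
        by (simp add: log_nearness_def ln_div)
      then show ?thesis
        unfolding t_def using \<open>cmod _ > 0\<close> by (metis exp_less_mono exp_ln)
    qed
    show ?thesis
    proof (cases "F = {}")
      case True
      then show ?thesis
        using T assms(3) by (simp add: T_def[symmetric])
    next
      case F: False
      then have z0: "z n \<noteq> 0"
        using nearness_carleson_box(1)[OF disc disc near] t4 by (metis all_not_in_conv less_imp_le)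
      define I where "I = centred_arc (z n / of_real (cmod (z n))) (4 * t)"
      have unit: "cmod (z n / of_real (cmod (z n))) = 1"
        using z0 by (simp add: norm_divide)
      have len: "arc_len I = 4 * t"
        unfolding I_def by (rule arc_len_centred_arc[OF unit]) (use t0 t4 in auto)
      have "(\<Sum>m\<in>F. 1 / kernel_diag (z m)) \<le> measure (dirichlet_measure z) (carleson_box I)"
        unfolding I_def
        by (intro sum_le_measure_dirichlet nearness_carleson_box disc near assms less_imp_le[OF t4])
      also have "\<dots> \<le> C * inverse (ln (1 / arc_len I))"
        by (rule C) (use t0 t4 len is_circle_arc_centred_arc[OF unit] in \<open>auto simp: I_def\<close>)
      also have "ln (1 / arc_len I) = real k - 2 * ln 2"
        using ln_realpow[of 2 2] by (simp add: len ln_div ln_mult t_def)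
      also have "C * inverse (real k - 2 * ln 2) \<le> C * inverse ((real k + 1) / 4)"
        using False ln_2_less_1 assms(3) by (intro mult_left_mono le_imp_inverse_le) auto
      also have "\<dots> \<le> (3 * T + 4 * C) / (real k + 1)"
        using T by (simp add: field_simps)
      finally show ?thesis
        by (simp add: T_def)
    qed
  qed
qed

text \<open>Summing over level sets, \<open>\<Sum> L\<^sup>2 / d\<close> is at most the sum of \<open>(2 * k + 1) * (B / (k + 1)) \<le> 2 * B\<close>
over the integers \<open>k\<close> below the depth of \<open>z n\<close>, because the proximity \<open>L\<close> never exceeds that
depth. The result is at most of the order of the depth, that is, of the diagonal value \<open>d n\<close>, which
is the normalization in the Gram matrix.\<close>

lemma one_box_imp_column_bounded:
  assumes "range z \<subseteq> ball 0 1" "one_box z"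
  shows "column_bounded z"
proof -
  have fin: "finite_measure (dirichlet_measure z)"
    using assms by (simp add: one_box_def)
  obtain C where "C > 0" and C: "\<And>I. is_circle_arc I \<Longrightarrow> 0 < arc_len I \<Longrightarrow> arc_len I < 1 \<Longrightarrow>
        measure (dirichlet_measure z) (carleson_box I) \<le> C * inverse (ln (1 / arc_len I))"
    using assms by (auto simp: one_box_def)
  define T where "T = measure (dirichlet_measure z) UNIV"
  define B where "B = 3 * T + 4 * C"
  have T: "0 \<le> T"
    by (simp add: T_def)
  have B: "0 \<le> B"
    using T \<open>C > 0\<close> by (simp add: B_def)
  have disc: "cmod (z m) < 1" for m
    using assms(1) by (auto simp: image_subset_iff)
  define d where "d m = kernel_diag (z m)" for m
  have d: "1 / 2 \<le> d m" "0 < d m" for m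
    using kernel_diag_ge_half[OF disc, of m] by (auto simp: d_def)
  show ?thesis
  proof (rule column_boundedI)
    fix n N
    define L where "L m = log_nearness (z n) (z m)" for m
    define l where "l m = nat \<lceil>L m\<rceil>" for m
    define M where "M = ln (1 / (1 - cmod (z n)))"
    define P where "P = nat \<lceil>M\<rceil>"
    have LM: "L m \<le> M" for m
      unfolding L_def M_def by (rule log_nearness_le_depth[OF disc disc])
    have M0: "0 \<le> M"
      using disc[of n] by (simp add: M_def)
    have P: "real P \<le> 5 * d n"
      using kernel_diag_ge_depth[OF disc, of n] M0 d[of n] unfolding P_def M_def[symmetric] d_def
      by linarith
    have tail: "(\<Sum>m<N. 1 / d m * of_bool (real k < L m)) \<le> B / (real k + 1)" for k
    proof -
      have "(\<Sum>m<N. 1 / d m * of_bool (real k < L m)) =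
          (\<Sum>m\<in>{m\<in>{..<N}. real k < L m}. 1 / d m)"
        by (subst sum.inter_filter) (auto intro!: sum.cong)
      also have "\<dots> \<le> B / (real k + 1)"
        unfolding B_def T_def d_def
        by (rule one_box_tail[OF assms(1) fin \<open>C > 0\<close> C]) (auto simp: L_def)
      finally show ?thesis .
    qed
    have K: "(cmod (dirichlet_kernel (z n) (z m)))\<^sup>2 \<le> 8 * (real (l m))\<^sup>2 + 128" for m
    proof -
      have "cmod (dirichlet_kernel (z n) (z m)) \<le> 2 * L m + 8"
        unfolding L_def by (rule kernel_norm_le_log_nearness[OF disc disc])
      also have "L m \<le> real (l m)"
        unfolding l_def by linarith
      finally have "(cmod (dirichlet_kernel (z n) (z m)))\<^sup>2 \<le> (2 * real (l m) + 8)\<^sup>2"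
        by (intro power_mono) auto
      also have "\<dots> \<le> 8 * (real (l m))\<^sup>2 + 128"
        using zero_le_power2[of "2 * real (l m) - 8"] by (simp add: power2_eq_square algebra_simps)
      finally show ?thesis .
    qed
    have "(\<Sum>m<N. 1 / d m * (real (l m))\<^sup>2) \<le>
        (\<Sum>m<N. 1 / d m * (\<Sum>k<P. (2 * real k + 1) * of_bool (real k < L m)))"
      unfolding l_def P_def using d LM
      by (intro sum_mono mult_left_mono square_nat_ceiling_le_sum nat_mono ceiling_mono)
        (auto simp: less_imp_le)
    also have "\<dots> = (\<Sum>k<P. (2 * real k + 1) * (\<Sum>m<N. 1 / d m * of_bool (real k < L m)))"
      unfolding sum_distrib_left by (subst sum.swap) (simp only: ac_simps)
    also have "\<dots> \<le> (\<Sum>k<P. (2 * real k + 1) * (B / (real k + 1)))"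
      using tail by (intro sum_mono mult_left_mono) auto
    also have "\<dots> \<le> (\<Sum>k<P. 2 * B)"
      using B by (intro sum_mono) (simp add: field_simps)
    also have "\<dots> \<le> 10 * B * d n"
      using mult_left_mono[OF P B] by simp
    finally have log_part: "(\<Sum>m<N. 1 / d m * (real (l m))\<^sup>2) \<le> 10 * B * d n" .
    have const_part: "(\<Sum>m<N. 1 / d m) \<le> T"
      unfolding T_def d_def by (rule sum_le_measure_dirichlet[OF assms(1) fin]) auto
    have "(\<Sum>m<N. (cmod (dirichlet_gram z n m))\<^sup>2) =
        (\<Sum>m<N. 1 / d m * (cmod (dirichlet_kernel (z n) (z m)))\<^sup>2) / d n"
      unfolding sum_divide_distrib
      by (intro sum.cong refl) (simp add: norm_gram_squared[OF disc disc] d_def)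
    also have "\<dots> \<le> (\<Sum>m<N. 1 / d m * (8 * (real (l m))\<^sup>2 + 128)) / d n"
      using d K by (intro divide_right_mono sum_mono mult_left_mono) (auto simp: less_imp_le)
    also have "\<dots> = (8 * (\<Sum>m<N. 1 / d m * (real (l m))\<^sup>2) + 128 * (\<Sum>m<N. 1 / d m)) / d n"
      unfolding sum_distrib_left sum.distrib[symmetric]
      by (intro arg_cong2[of _ _ _ _ "(/)"] sum.cong refl) (simp add: algebra_simps)
    also have "\<dots> \<le> (8 * (10 * B * d n) + 128 * T) / d n"
      using log_part const_part d[of n] by (intro divide_right_mono add_mono mult_left_mono) auto
    also have "\<dots> = 80 * B + 128 * T / d n"
      using d(2)[of n] by (simp add: field_simps)
    also have "128 * T / d n \<le> 128 * T / (1 / 2)"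
      using d[of n] T by (intro divide_left_mono) auto
    finally show "(\<Sum>m<N. (cmod (dirichlet_gram z n m))\<^sup>2) \<le> 80 * B + 256 * T"
      by simp
  qed
qed

section \<open>Column bounded implies restricted one box\<close>

text \<open>Points of the enlarged box of \<open>z\<close> share a fixed proportion of the depth of \<open>z\<close>, so the kernel
there is comparable with its value on the diagonal. The constant \<open>3\<close> absorbs \<open>ln 6\<close>.\<close>

lemma log_nearness_carleson_box_ge:
  assumes "cmod z < 1" "z \<noteq> 0" "cmod w < 1" "0 < \<delta>" "\<delta> \<le> 1"
    and "w \<in> carleson_box (centred_arc (z / of_real (cmod z)) ((1 - cmod z) powr \<delta>))"
  shows "\<delta> * ln (1 / (1 - cmod z)) - 3 \<le> log_nearness z w"
proof -
  define r where "r = 1 - cmod z"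
  have r: "0 < r" "r \<le> 1"
    using assms by (auto simp: r_def)
  have rd: "r powr 1 \<le> r powr \<delta>" "r powr \<delta> \<le> r powr 0"
    using r assms by (intro powr_mono'; simp)+
  have le: "cmod (1 - z * cnj w) \<le> 6 * r powr \<delta>"
    using assms r rd unfolding r_def
    by (intro carleson_box_nearness) auto
  have pos: "cmod (1 - z * cnj w) > 0"
    using norm_mult_cnj_less_1[OF assms(1,3)] by auto
  have "ln (cmod (1 - z * cnj w)) \<le> ln (6 * r powr \<delta>)"
    using le pos by (subst ln_le_cancel_iff) auto
  also have "\<dots> = ln 6 + \<delta> * ln r"
    using r by (simp add: ln_mult ln_powr)
  also have "ln 6 \<le> (3::real)"
  proof -
    have "ln 6 \<le> ln (8 :: real)"
      by simp
    moreover have "ln 8 = 3 * ln (2 :: real)"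
      using ln_realpow[of 2 3] by simp
    ultimately show ?thesis
      using ln_2_less_1 by linarith
  qed
  finally have "ln (cmod (1 - z * cnj w)) \<le> 3 + \<delta> * ln r"
    by simp
  then show ?thesis
    using pos r by (simp add: log_nearness_def ln_div r_def[symmetric])
qed

text \<open>Only the terms of the column sum that belong to the box are used. There the squared kernel is of
order \<open>M\<^sup>2\<close>, with \<open>M\<close> the depth of \<open>z n\<close>, while the normalization only divides by \<open>d n\<close>, which is
of order \<open>M\<close>; hence the mass of the box is of order \<open>1 / M\<close>. Any exponent \<open>\<delta>\<close> in \<open>(0, 1)\<close> would
do, and \<open>1 / 2\<close> is chosen.\<close>

lemma column_bounded_imp_restricted_one_box:
  assumes "range z \<subseteq> ball 0 1" "column_bounded z"
  shows "restricted_one_box z"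
proof -
  obtain C where C: "\<And>n F. finite F \<Longrightarrow> (\<Sum>m\<in>F. (cmod (dirichlet_gram z n m))\<^sup>2) \<le> C"
    using column_boundedD[OF assms(2)] by blast
  have C0: "0 \<le> C"
    using C[of "{}"] by simp
  have disc: "cmod (z m) < 1" for m
    using assms(1) by (auto simp: image_subset_iff)
  define d where "d m = kernel_diag (z m)" for m
  have d: "0 < d m" for m
    using kernel_diag_ge_half[OF disc, of m] by (auto simp: d_def)
  have weight: "1 / d m * c\<^sup>2 \<le> d n * (cmod (dirichlet_gram z n m))\<^sup>2"
    if "0 \<le> c" "c \<le> cmod (dirichlet_kernel (z n) (z m))" for n m c
  proof -
    have "1 / d m * c\<^sup>2 \<le> 1 / d m * (cmod (dirichlet_kernel (z n) (z m)))\<^sup>2"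
      using d[of m] that by (intro mult_left_mono power_mono) auto
    also have "\<dots> = d n * (cmod (dirichlet_gram z n m))\<^sup>2"
      using d[of n] by (simp add: norm_gram_squared[OF disc disc] d_def)
    finally show ?thesis .
  qed
  have "summable (\<lambda>m. (cmod (dirichlet_gram z 0 m))\<^sup>2)"
    by (rule summableI_nonneg_bounded[where x = C]) (use C in auto)
  then have "summable (\<lambda>m. 4 * d 0 * (cmod (dirichlet_gram z 0 m))\<^sup>2)"
    by (rule summable_mult)
  moreover have "norm (1 / d m) \<le> 4 * d 0 * (cmod (dirichlet_gram z 0 m))\<^sup>2" for m
    using weight[of "1 / 2" 0 m] kernel_norm_ge_half[OF disc disc] d[of m]
    by (simp add: power2_eq_square)
  ultimately have "summable (\<lambda>m. 1 / d m)"
    by (rule summable_comparison_test'[where N = 0])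
  then have fin: "finite_measure (dirichlet_measure z)"
    unfolding d_def by (rule finite_dirichlet_measureI[OF assms(1)])
  define T where "T = measure (dirichlet_measure z) UNIV"
  have T: "0 \<le> T"
    by (simp add: T_def)
  have box: "measure (dirichlet_measure z)
      (carleson_box (centred_arc (z n / of_real (cmod (z n))) ((1 - cmod (z n)) powr (1 / 2))))
    \<le> (48 * C + 12 * T + 1) * inverse (ln (1 / (1 - cmod (z n))))" if z0: "z n \<noteq> 0" for n
  proof -
    let ?S = "carleson_box (centred_arc (z n / of_real (cmod (z n))) ((1 - cmod (z n)) powr (1 / 2)))"
    define M where "M = ln (1 / (1 - cmod (z n)))"
    have M0: "0 < M"
      using disc[of n] z0 by (simp add: M_def)
    have "measure (dirichlet_measure z) ?S \<le> (48 * C + 12 * T) / M"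
    \<comment> \<open>Shallow points: for bounded \<open>M\<close> the total mass is an admissible bound.\<close>
    proof (cases "M < 12")
      case True
      interpret finite_measure "dirichlet_measure z"
        by fact
      have "measure (dirichlet_measure z) ?S \<le> T"
        unfolding T_def by (rule finite_measure_mono) auto
      also have "T * M \<le> T * 12"
        using True T by (intro mult_left_mono) auto
      then have "T \<le> (48 * C + 12 * T) / M"
        using C0 M0 by (simp add: field_simps)
      finally show ?thesis .
    next
      case False
      have "measure (dirichlet_measure z) ?S \<le> 48 * C / M"
      proof (rule measure_dirichlet_le[OF assms(1)])
        fix F assume F: "finite F" "z ` F \<subseteq> ?S"
        have "(\<Sum>m\<in>F. 1 / d m) * (M / 4)\<^sup>2 \<le> (\<Sum>m\<in>F. d n * (cmod (dirichlet_gram z n m))\<^sup>2)"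
          unfolding sum_distrib_right
        proof (intro sum_mono weight)
          fix m assume "m \<in> F"
          then have "1 / 2 * M - 3 \<le> log_nearness (z n) (z m)"
            unfolding M_def using F
            by (intro log_nearness_carleson_box_ge disc z0) auto
          then show "M / 4 \<le> cmod (dirichlet_kernel (z n) (z m))"
            using kernel_norm_ge_log_nearness[OF disc disc, of n m] False by simp
        qed (use M0 in auto)
        also have "\<dots> \<le> d n * C"
          unfolding sum_distrib_left[symmetric] using d[of n] C[OF F(1)]
          by (intro mult_left_mono) auto
        also have "d n \<le> 3 * M"
          using kernel_diag_le_depth[OF disc, of n] False by (simp add: d_def M_def)
        finally have "(\<Sum>m\<in>F. 1 / d m) * (M / 4)\<^sup>2 \<le> 3 * M * C"
          using C0 mult_right_mono by fastforce
        then show "(\<Sum>m\<in>F. 1 / kernel_diag (z m)) \<le> 48 * C / M"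
          using M0 by (simp add: d_def power2_eq_square field_simps)
      qed (use C0 M0 in auto)
      also have "\<dots> \<le> (48 * C + 12 * T) / M"
        using T M0 by (intro divide_right_mono) auto
      finally show ?thesis .
    qed
    also have "\<dots> \<le> (48 * C + 12 * T + 1) * inverse M"
      using M0 by (simp add: field_simps)
    finally show ?thesis
      by (simp add: M_def)
  qed
  have "0 < 48 * C + 12 * T + 1" "0 < (1 / 2 :: real)" "(1 / 2 :: real) < 1"
    using C0 T by auto
  then show ?thesis
    unfolding restricted_one_box_def using fin box by blast
qed

section \<open>Clusters of equally deep points\<close>

text \<open>Cluster \<open>0\<close> is \<open>{0}\<close>, and cluster \<open>Suc j\<close> consists of the indices with
\<open>4 ^ j \<le> n < 4 ^ Suc j\<close>.\<close>

definition cluster :: "nat \<Rightarrow> nat" where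
  "cluster n = floorlog 4 n"

definition depth :: "nat \<Rightarrow> real" where
  "depth k = 64 * 16 ^ k"

text \<open>The points of cluster \<open>k\<close> are equally spaced in an arc that starts at the angle \<open>1 / 2 ^ k\<close> and has
length at most \<open>exp (- (8 * b ^ k))\<close>. Hence two of them have proximity about \<open>8 * b ^ k\<close>, the loss
from the number of points being only \<open>k * ln 4\<close>, whereas points of different clusters have
proximity at most linear in the smaller cluster index. The parameter \<open>b\<close> decides how tightly the
clusters are packed in comparison with the depth \<open>64 * 16 ^ k\<close> of their points.\<close>

definition cluster_angle :: "real \<Rightarrow> nat \<Rightarrow> real" where
  "cluster_angle b n = 1 / 2 ^ cluster n + exp (- (8 * b ^ cluster n)) * (real n / 4 ^ cluster n)"

definition cluster_seq :: "real \<Rightarrow> nat \<Rightarrow> complex" where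
  "cluster_seq b n = of_real (1 - exp (- depth (cluster n))) * cis (cluster_angle b n)"

lemma less_power_cluster: "n < 4 ^ cluster n"
  using floorlog_bounds[of n 4] by (cases "n = 0") (auto simp: cluster_def)

lemma cluster_eqI:
  assumes "4 ^ j \<le> n" "n < 4 ^ Suc j"
  shows "cluster n = Suc j"
  unfolding cluster_def
  using assms by (intro antisym floorlog_leI floorlog_geI) auto

lemma card_cluster_le: "finite F \<Longrightarrow> (\<And>m. m \<in> F \<Longrightarrow> cluster m = k) \<Longrightarrow> card F \<le> 4 ^ k"
  using less_power_cluster card_mono[of "{..<4 ^ k}" F] by fastforce

lemma depth_ge: "64 \<le> depth k"
  by (simp add: depth_def)

lemma norm_cluster_seq: "cmod (cluster_seq b n) = 1 - exp (- depth (cluster n))"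
proof -
  have "0 \<le> 1 - exp (- depth (cluster n))"
    using depth_ge[of "cluster n"] by simp
  then show ?thesis
    unfolding cluster_seq_def norm_mult norm_of_real norm_cis by simp
qed

lemma cluster_seq_nonzero: "cluster_seq b n \<noteq> 0"
  using norm_cluster_seq[of b n] depth_ge[of "cluster n"] by auto

lemma cluster_seq_in_disc: "cmod (cluster_seq b n) < 1"
  by (simp add: norm_cluster_seq)

lemma depth_cluster_seq: "ln (1 / (1 - cmod (cluster_seq b n))) = depth (cluster n)"
  by (simp add: norm_cluster_seq ln_div)

lemma kernel_diag_cluster_ge: "63 * 16 ^ cluster n \<le> kernel_diag (cluster_seq b n)"
proof -
  have "1 \<le> (16::real) ^ cluster n"
    by (rule one_le_power) simp
  then show ?thesis
    using kernel_diag_ge_depth[OF cluster_seq_in_disc, of b n]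
    unfolding depth_cluster_seq depth_def by linarith
qed

lemma kernel_diag_cluster_le: "kernel_diag (cluster_seq b n) \<le> 192 * 16 ^ cluster n"
proof -
  have "1 \<le> (16::real) ^ cluster n"
    by (rule one_le_power) simp
  then show ?thesis
    using kernel_diag_le_depth[OF cluster_seq_in_disc, of b n]
    unfolding depth_cluster_seq depth_def by linarith
qed

context
  fixes b :: real
  assumes b: "8 \<le> b" "b \<le> 16"
begin

lemma power_base_bounds: "8 ^ k \<le> b ^ k" "b ^ k \<le> 16 ^ k"
  using b by (auto intro: power_mono)

text \<open>Each cluster is short enough not to reach the next larger starting angle, which is twice its own.\<close>

lemma exp_spread_le: "exp (- (8 * b ^ k)) \<le> 1 / (2 * 2 ^ k)"
proof -
  have "2 * 2 ^ k \<le> 8 * (8::real) ^ k"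
    by (intro mult_mono power_mono) auto
  also have "\<dots> \<le> 8 * b ^ k"
    using power_base_bounds(1)[of k] by simp
  also have "\<dots> \<le> exp (8 * b ^ k)"
    using exp_ge_add_one_self[of "8 * b ^ k"] by linarith
  finally show ?thesis
    by (simp add: exp_minus field_simps)
qed

lemma cluster_angle_bounds:
  "1 / 2 ^ cluster n \<le> cluster_angle b n"
  "cluster_angle b n \<le> 1 / 2 ^ cluster n + exp (- (8 * b ^ cluster n))"
proof -
  have "real n < 4 ^ cluster n"
    using less_power_cluster[of n] by (metis of_nat_less_iff of_nat_numeral of_nat_power)
  then have "real n / 4 ^ cluster n \<le> 1"
    by simp
  then have "exp (- (8 * b ^ cluster n)) * (real n / 4 ^ cluster n) \<le>
      exp (- (8 * b ^ cluster n)) * 1"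
    by (intro mult_left_mono) auto
  then show "cluster_angle b n \<le> 1 / 2 ^ cluster n + exp (- (8 * b ^ cluster n))"
    by (simp add: cluster_angle_def)
qed (simp add: cluster_angle_def)

lemma cluster_angle_diff_le_2: "\<bar>cluster_angle b n - cluster_angle b m\<bar> \<le> 2"
proof -
  have "0 \<le> cluster_angle b n \<and> cluster_angle b n \<le> 2" for n
  proof -
    have "0 \<le> 1 / (2::real) ^ cluster n" "1 / (2::real) ^ cluster n \<le> 1"
      by simp_all
    moreover have "1 / (2 * 2 ^ cluster n) = (1 / 2 ^ cluster n) / (2::real)"
      by simp
    ultimately show ?thesis
      using cluster_angle_bounds[of n] exp_spread_le[of "cluster n"] by linarith
  qed
  from this[of n] this[of m] show ?thesis
    by linarith
qed

lemma cluster_angle_gap_same: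
  assumes "n \<noteq> m" "cluster n = k" "cluster m = k"
  shows "exp (- (8 * b ^ k)) / 4 ^ k \<le> \<bar>cluster_angle b n - cluster_angle b m\<bar>"
proof -
  have "1 \<le> \<bar>real n - real m\<bar>"
    using assms by linarith
  then have "exp (- (8 * b ^ k)) / 4 ^ k * 1 \<le> exp (- (8 * b ^ k)) / 4 ^ k * \<bar>real n - real m\<bar>"
    by (intro mult_left_mono) auto
  also have "\<dots> = \<bar>exp (- (8 * b ^ k)) / 4 ^ k * (real n - real m)\<bar>"
    by (simp add: abs_mult)
  also have "exp (- (8 * b ^ k)) / 4 ^ k * (real n - real m) = cluster_angle b n - cluster_angle b m"
    using assms by (simp add: cluster_angle_def field_simps)
  finally show ?thesis
    by simp
qed

lemma cluster_angle_gap_less: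
  assumes "cluster n < cluster m"
  shows "1 / (4 * 2 ^ cluster n) \<le> cluster_angle b n - cluster_angle b m"
proof -
  have "(2::real) * 2 ^ cluster n \<le> 2 ^ cluster m"
    using power_increasing[of "Suc (cluster n)" "cluster m" "2::real"] assms by simp
  then have "1 / 2 ^ cluster m \<le> 1 / ((2::real) * 2 ^ cluster n)"
    by (intro divide_left_mono) auto
  moreover have "cluster_angle b m \<le> 1 / 2 ^ cluster m + 1 / (2 * 2 ^ cluster m)"
    using cluster_angle_bounds(2)[of m] exp_spread_le[of "cluster m"] by linarith
  moreover have "1 / (2 * 2 ^ cluster m) = (1 / 2 ^ cluster m) / (2::real)"
    "1 / (4 * 2 ^ cluster n) = (1 / 2 ^ cluster n) / (4::real)"
    "1 / (2 * 2 ^ cluster n) = (1 / 2 ^ cluster n) / (2::real)"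
    by simp_all
  ultimately show ?thesis
    using cluster_angle_bounds(1)[of n] by linarith
qed

lemma cluster_seq_mult_cnj:
  "cluster_seq b n * cnj (cluster_seq b m) =
    of_real (cmod (cluster_seq b n) * cmod (cluster_seq b m)) *
    cis (cluster_angle b n - cluster_angle b m)"
proof -
  have "cis (cluster_angle b n - cluster_angle b m) =
      cis (cluster_angle b n) * cnj (cis (cluster_angle b m))"
    by (simp add: cis_cnj cis_mult)
  then show ?thesis
    unfolding norm_cluster_seq by (simp add: cluster_seq_def)
qed

lemma log_nearness_le_angle:
  assumes "0 < g" "g \<le> \<bar>cluster_angle b n - cluster_angle b m\<bar>"
  shows "log_nearness (cluster_seq b n) (cluster_seq b m) \<le> 3 - ln g"
proof -
  let ?u = "cluster_seq b n * cnj (cluster_seq b m)"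
  let ?x = "cluster_angle b n - cluster_angle b m"
  have pos: "0 < cmod (cluster_seq b n) * cmod (cluster_seq b m)"
    using cluster_seq_nonzero by simp
  have "\<bar>?x\<bar> \<le> 2"
    by (rule cluster_angle_diff_le_2)
  then have "Arg (cis ?x) = ?x"
    using pi_gt3 by (intro cis_Arg_unique) auto
  then have "Arg ?u = ?x"
    unfolding cluster_seq_mult_cnj using pos by (simp only: Arg_times_of_real)
  moreover have "?u \<noteq> 0"
    using cluster_seq_nonzero by simp
  ultimately have le: "g / 8 \<le> cmod (1 - ?u)"
    using abs_Arg_le[of ?u] assms by simp
  moreover have "0 < g / 8"
    using assms by simp
  ultimately have "ln (g / 8) \<le> ln (cmod (1 - ?u))"
    by (subst ln_le_cancel_iff) linarith+
  moreover have "ln (g / 8) \<ge> ln g - 3"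
    using ln_2_less_1 ln_realpow[of 2 3] assms by (simp add: ln_div)
  moreover have "1 - ?u \<noteq> 0"
    using le \<open>0 < g / 8\<close> by auto
  ultimately show ?thesis
    by (simp add: log_nearness_def ln_div)
qed

text \<open>The constant collects \<open>2 * (8 * b ^ k + 2 * k + 3) + 8\<close>, where \<open>k + 1 \<le> 8 ^ k \<le> b ^ k\<close>.\<close>

lemma kernel_le_same_cluster:
  assumes "n \<noteq> m" "cluster n = k" "cluster m = k"
  shows "cmod (dirichlet_kernel (cluster_seq b n) (cluster_seq b m)) \<le> 30 * b ^ k"
proof -
  have "ln (4::real) \<le> 2"
    using ln_2_less_1 ln_realpow[of 2 2] by simp
  then have "real k * ln 4 \<le> real k * 2"
    by (intro mult_left_mono) auto
  moreover have "ln (exp (- (8 * b ^ k)) / 4 ^ k) = - (8 * b ^ k) - real k * ln 4"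
    by (simp add: ln_div ln_realpow)
  ultimately have "log_nearness (cluster_seq b n) (cluster_seq b m) \<le> 3 + 8 * b ^ k + 2 * real k"
    using log_nearness_le_angle[OF _ cluster_angle_gap_same[OF assms]] by simp
  moreover have "real k + 1 \<le> 8 ^ k"
    using Bernoulli_inequality[of "7::real" k] by simp
  ultimately show ?thesis
    using kernel_norm_le_log_nearness[OF cluster_seq_in_disc cluster_seq_in_disc, of b n b m]
      power_base_bounds(1)[of k] by linarith
qed

text \<open>The gap between the arcs of two clusters is governed by the one with the smaller index \<open>k\<close> and is
at least \<open>1 / (4 * 2 ^ k)\<close>. This gives \<open>2 * (k + 5) + 8\<close>, which is replaced by a multiple of
\<open>4 ^ k\<close>, the order of the square root of the depth.\<close>

lemma kernel_le_other_cluster: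
  assumes "cluster n \<noteq> cluster m"
  shows "cmod (dirichlet_kernel (cluster_seq b n) (cluster_seq b m))
    \<le> 18 * 4 ^ min (cluster n) (cluster m)"
proof -
  define k where "k = min (cluster n) (cluster m)"
  have "1 / (4 * 2 ^ k) \<le> \<bar>cluster_angle b n - cluster_angle b m\<bar>"
    using cluster_angle_gap_less[of n m] cluster_angle_gap_less[of m n] assms
    by (cases "cluster n < cluster m") (auto simp: k_def)
  then have "log_nearness (cluster_seq b n) (cluster_seq b m) \<le> 3 - ln (1 / (4 * 2 ^ k))"
    by (intro log_nearness_le_angle) auto
  also have "\<dots> = 3 + (2 + real k) * ln 2"
    using ln_realpow[of 2 2] by (simp add: ln_div ln_mult ln_realpow algebra_simps)
  also have "\<dots> \<le> 3 + (2 + real k) * 1"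
    using ln_2_less_1 by (intro add_left_mono mult_left_mono) auto
  finally have "log_nearness (cluster_seq b n) (cluster_seq b m) \<le> real k + 5"
    by simp
  moreover have "real k + 1 \<le> 4 ^ k"
    using Bernoulli_inequality[of "3::real" k] by simp
  ultimately show ?thesis
    unfolding k_def[symmetric]
    using kernel_norm_le_log_nearness[OF cluster_seq_in_disc cluster_seq_in_disc, of b n b m]
    by linarith
qed

text \<open>Distinct points have a kernel value of at most half the depth of the shallower one; weak
separation and the restricted one box condition both follow from this.\<close>

lemma kernel_le_depth:
  assumes "n \<noteq> m"
  shows "cmod (dirichlet_kernel (cluster_seq b n) (cluster_seq b m))
    \<le> 32 * 16 ^ min (cluster n) (cluster m)"
proof (cases "cluster n = cluster m")
  case True
  then have "cmod (dirichlet_kernel (cluster_seq b n) (cluster_seq b m)) \<le> 30 * b ^ cluster n"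
    using assms by (intro kernel_le_same_cluster) auto
  also have "\<dots> \<le> 32 * 16 ^ cluster n"
    using power_base_bounds(2)[of "cluster n"] zero_le_power[of "16::real" "cluster n"] by linarith
  finally show ?thesis
    using True by simp
next
  case False
  have "(4::real) ^ min (cluster n) (cluster m) \<le> 16 ^ min (cluster n) (cluster m)"
    by (intro power_mono) auto
  then show ?thesis
    using kernel_le_other_cluster[OF False] zero_le_power[of "16::real" "min (cluster n) (cluster m)"]
    by linarith
qed

lemma log_nearness_ge_same_cluster:
  assumes "cluster n = k" "cluster m = k"
  shows "8 * b ^ k - 2 \<le> log_nearness (cluster_seq b n) (cluster_seq b m)"
proof -
  let ?u = "cluster_seq b n * cnj (cluster_seq b m)"
  let ?x = "cluster_angle b n - cluster_angle b m"
  define e where "e = exp (- depth k)"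
  define q where "q = (1 - e) * (1 - e)"
  have e: "0 < e" "e \<le> 1"
    using depth_ge[of k] by (auto simp: e_def)
  have "8 * b ^ k \<le> 64 * 16 ^ k"
    using power_base_bounds(2)[of k] zero_le_power[of "16::real" k] by linarith
  then have e_le: "e \<le> exp (- (8 * b ^ k))"
    by (simp add: e_def depth_def)
  have q: "0 \<le> q" "q \<le> 1" "1 - q \<le> 2 * e"
    using e zero_le_square[of e] zero_le_square[of "1 - e"]
    unfolding q_def by (auto simp: mult_le_one, simp add: algebra_simps)
  have x: "\<bar>?x\<bar> \<le> exp (- (8 * b ^ k))"
    using cluster_angle_bounds[of n] cluster_angle_bounds[of m] assms by simp
  have u: "?u = of_real q * cis ?x"
    unfolding cluster_seq_mult_cnj norm_cluster_seq assms q_def e_def ..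
  have "cmod (1 - ?u) \<le> (1 - q) + \<bar>?x\<bar>"
    unfolding u by (rule norm_one_minus_polar_le[OF q(1,2)])
  also have "\<dots> \<le> 4 * exp (- (8 * b ^ k))"
    using q x e_le by simp
  finally have le: "cmod (1 - ?u) \<le> 4 * exp (- (8 * b ^ k))" .
  have pos: "0 < cmod (1 - ?u)"
    using norm_mult_cnj_less_1[OF cluster_seq_in_disc cluster_seq_in_disc, of b n b m] by auto
  have "ln (cmod (1 - ?u)) \<le> ln (4 * exp (- (8 * b ^ k)))"
    using le pos by (subst ln_le_cancel_iff) auto
  also have "\<dots> \<le> 2 - 8 * b ^ k"
    using ln_2_less_1 ln_realpow[of 2 2] by (simp add: ln_mult)
  finally show ?thesis
    using pos by (simp add: log_nearness_def ln_div)
qed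

lemma cluster_seq_range: "range (cluster_seq b) \<subseteq> ball 0 1"
  using cluster_seq_in_disc by auto

lemma summable_cluster_weights: "summable (\<lambda>m. 1 / kernel_diag (cluster_seq b m))"
proof (rule summable_comparison_test'[where N = 0])
  \<comment> \<open>The weight of \<open>m\<close> is of order \<open>1 / 16 ^ k\<close>, and \<open>m < 4 ^ k\<close> for its cluster \<open>k\<close>.\<close>
  show "summable (\<lambda>m. inverse ((real (Suc m))\<^sup>2))"
    using inverse_power_summable[of 2, where ?'a = real]
    by (subst summable_Suc_iff) auto
  fix m
  have "real (Suc m) \<le> 4 ^ cluster m"
    using less_power_cluster[of m]
    by (metis Suc_leI of_nat_le_iff of_nat_numeral of_nat_power)
  then have "(real (Suc m))\<^sup>2 \<le> (4 ^ cluster m)\<^sup>2"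
    by (intro power_mono) auto
  also have "\<dots> = (16::real) ^ cluster m"
    by (simp add: power2_eq_square power_mult_distrib[symmetric])
  also have "\<dots> \<le> kernel_diag (cluster_seq b m)"
    using kernel_diag_cluster_ge[of m b] zero_le_power[of "16::real" "cluster m"] by linarith
  finally show "norm (1 / kernel_diag (cluster_seq b m)) \<le> inverse ((real (Suc m))\<^sup>2)"
    using le_imp_inverse_le[of "(real (Suc m))\<^sup>2" "kernel_diag (cluster_seq b m)"]
      kernel_diag_ge_half[OF cluster_seq_in_disc, of b m]
    by (simp add: inverse_eq_divide)
qed

lemma finite_cluster_measure: "finite_measure (dirichlet_measure (cluster_seq b))"
  by (rule finite_dirichlet_measureI[OF cluster_seq_range summable_cluster_weights])

lemma weakly_separated_cluster_seq: "weakly_separated (cluster_seq b)"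
proof -
  have "cmod (dirichlet_gram (cluster_seq b) n m) \<le> 3 / 4" if "n \<noteq> m" for n m
  proof (rule power2_le_imp_le)
    define p :: real where "p = 16 ^ min (cluster n) (cluster m)"
    have p: "p > 0" "p \<le> 16 ^ cluster n" "p \<le> 16 ^ cluster m"
      by (auto simp: p_def intro: power_increasing)
    have "(cmod (dirichlet_gram (cluster_seq b) n m))\<^sup>2 \<le> (32 * p)\<^sup>2 / ((63 * p) * (63 * p))"
      unfolding norm_gram_squared[OF cluster_seq_in_disc cluster_seq_in_disc]
      using p kernel_diag_cluster_ge[of n b] kernel_diag_cluster_ge[of m b]
        kernel_le_depth[OF that]
      by (intro frac_le power_mono mult_mono) (auto simp: p_def[symmetric])
    also have "\<dots> \<le> (3 / 4)\<^sup>2"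
      using p by (simp add: power2_eq_square)
    finally show "(cmod (dirichlet_gram (cluster_seq b) n m))\<^sup>2 \<le> (3 / 4)\<^sup>2" .
  qed simp
  then have "(SUP (n, m) \<in> {(n, m). n \<noteq> m}. ereal (cmod (dirichlet_gram (cluster_seq b) n m)))
      \<le> ereal (3 / 4)"
    by (intro SUP_least) auto
  also have "ereal (3 / 4) < 1"
    by simp
  finally show ?thesis
    by (simp add: weakly_separated_def)
qed

text \<open>A point of the box with exponent \<open>3 / 4\<close> has proximity about three quarters of the depth to the
centre, but distinct points of the sequence have at most half of it. So each restricted box
contains no term but its own centre, whose weight is of the required order.\<close>

lemma restricted_one_box_cluster_seq: "restricted_one_box (cluster_seq b)"
proof -
  let ?z = "cluster_seq b"
  have box: "measure (dirichlet_measure ?z)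
      (carleson_box (centred_arc (?z n / of_real (cmod (?z n))) ((1 - cmod (?z n)) powr (3 / 4))))
    \<le> 2 * inverse (ln (1 / (1 - cmod (?z n))))" for n
  proof (rule measure_dirichlet_le[OF cluster_seq_range])
    show "0 \<le> 2 * inverse (ln (1 / (1 - cmod (?z n))))"
      using depth_ge[of "cluster n"] by (simp add: depth_cluster_seq)
    fix F assume F: "finite F" "?z ` F \<subseteq>
      carleson_box (centred_arc (?z n / of_real (cmod (?z n))) ((1 - cmod (?z n)) powr (3 / 4)))"
    have "m = n" if "m \<in> F" for m
    proof (rule ccontr)
      assume "m \<noteq> n"
      have "3 / 4 * depth (cluster n) - 3 \<le> log_nearness (?z n) (?z m)"
        unfolding depth_cluster_seq[of b, symmetric] using F that
        by (intro log_nearness_carleson_box_ge cluster_seq_in_disc cluster_seq_nonzero) auto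
      also have "\<dots> \<le> cmod (dirichlet_kernel (?z n) (?z m))"
        by (rule kernel_norm_ge_log_nearness[OF cluster_seq_in_disc cluster_seq_in_disc])
      also have "\<dots> \<le> 32 * 16 ^ min (cluster n) (cluster m)"
        using \<open>m \<noteq> n\<close> by (intro kernel_le_depth) auto
      also have "\<dots> \<le> 32 * 16 ^ cluster n"
        by (intro mult_left_mono power_increasing) auto
      finally show False
        using depth_ge[of "cluster n"] unfolding depth_def by linarith
    qed
    then have "(\<Sum>m\<in>F. 1 / kernel_diag (?z m)) \<le> (\<Sum>m\<in>{n}. 1 / kernel_diag (?z m))"
      using kernel_diag_ge_half[OF cluster_seq_in_disc, of b]
      by (intro sum_mono2) (auto simp: order_trans[OF _ kernel_diag_ge_half[OF cluster_seq_in_disc]])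
    also have "\<dots> \<le> 1 / (32 * 16 ^ cluster n)"
    proof -
      have "32 * 16 ^ cluster n \<le> kernel_diag (cluster_seq b n)"
        using kernel_diag_cluster_ge[of n b] zero_le_power[of "16::real" "cluster n"] by linarith
      then show ?thesis
        using kernel_diag_ge_half[OF cluster_seq_in_disc, of b n]
        by (auto intro!: divide_left_mono)
    qed
    also have "\<dots> = 2 * inverse (ln (1 / (1 - cmod (?z n))))"
      by (simp add: depth_cluster_seq depth_def field_simps)
    finally show "(\<Sum>m\<in>F. 1 / kernel_diag (?z m)) \<le> 2 * inverse (ln (1 / (1 - cmod (?z n))))" .
  qed
  have "0 < (2::real)" "0 < (3 / 4 :: real)" "(3 / 4 :: real) < 1"
    by auto
  then show ?thesis
    unfolding restricted_one_box_def using finite_cluster_measure box by blast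
qed

end

section \<open>Loosely packed clusters: column bounded but not one box\<close>

text \<open>In the column of a point of cluster \<open>k\<close>, the at most \<open>4 ^ k\<close> points of the same cluster contribute
terms of order \<open>(8 ^ k / 16 ^ k)\<^sup>2 = 1 / 4 ^ k\<close> each. For a point \<open>m\<close> of another cluster the kernel
is at most of order \<open>4 ^ k\<close>, whose square is of the order of the normalization \<open>d n\<close>; what
remains is the weight \<open>1 / d m\<close>, and the weights are summable.\<close>

lemma column_bounded_cluster_seq: "column_bounded (cluster_seq 8)"
proof -
  let ?z = "cluster_seq 8"
  define d where "d m = kernel_diag (?z m)" for m
  have d: "63 * 16 ^ cluster m \<le> d m" "0 < d m" for m
    using kernel_diag_cluster_ge[of m 8] kernel_diag_ge_half[OF cluster_seq_in_disc, of 8 m]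
    by (simp_all add: d_def)
  define S where "S = (\<Sum>m. 1 / d m)"
  have gram: "(cmod (dirichlet_gram ?z n m))\<^sup>2 = (cmod (dirichlet_kernel (?z n) (?z m)))\<^sup>2 / (d n * d m)"
    for n m
    unfolding d_def by (rule norm_gram_squared[OF cluster_seq_in_disc cluster_seq_in_disc])
  show ?thesis
  proof (rule column_boundedI)
    fix n N
    define k where "k = cluster n"
    have bound: "(cmod (dirichlet_gram ?z n m))\<^sup>2 \<le>
        of_bool (m = n) + of_bool (cluster m = k) * (1 / 4 ^ k) + 6 * (1 / d m)" for m
    proof (cases "m = n")
      case True
      have "(cmod (dirichlet_gram ?z n n))\<^sup>2 = 1"
        using d(2)[of n] kernel_diag_eq_norm[OF cluster_seq_in_disc, of 8 n]
        unfolding gram by (simp add: d_def power2_eq_square)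
      then show ?thesis
        using True d(2)[of n] by simp
    next
      case mn: False
      show ?thesis
      proof (cases "cluster m = k")
        case True
        have "(cmod (dirichlet_gram ?z n m))\<^sup>2 \<le>
            (30 * 8 ^ k)\<^sup>2 / ((63 * 16 ^ k) * (63 * 16 ^ k))"
          unfolding gram using d[of n] d[of m] True mn
            kernel_le_same_cluster[of 8 n m k]
          by (intro frac_le power_mono mult_mono) (auto simp: k_def)
        also have "\<dots> = (900 / 3969) * (1 / 4 ^ k)"
        proof -
          have "(8 ^ k)\<^sup>2 * 4 ^ k = (16 ^ k * 16 ^ k :: real)"
            by (simp add: power2_eq_square power_mult_distrib[symmetric])
          then show ?thesis
            by (simp add: power_mult_distrib field_simps)
        qed
        also have "\<dots> \<le> 1 * (1 / 4 ^ k)"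
          by (intro mult_right_mono) auto
        finally show ?thesis
          using True mn d(2)[of m] by (simp add: add_increasing2)
      next
        case False
        have "cmod (dirichlet_kernel (?z n) (?z m)) \<le> 18 * 4 ^ min (cluster n) (cluster m)"
          using False by (intro kernel_le_other_cluster) (auto simp: k_def)
        also have "\<dots> \<le> 18 * 4 ^ k"
          unfolding k_def by (intro mult_left_mono power_increasing) auto
        finally have "(cmod (dirichlet_gram ?z n m))\<^sup>2 \<le> (18 * 4 ^ k)\<^sup>2 / ((63 * 16 ^ k) * d m)"
          unfolding gram using d[of n] d(2)[of m]
          by (intro frac_le power_mono mult_right_mono) (auto simp: k_def)
        also have "\<dots> = (324 / 63) * (1 / d m)"
        proof -
          have "(4 ^ k)\<^sup>2 = (16 ^ k :: real)"
            by (simp add: power2_eq_square power_mult_distrib[symmetric])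
          then show ?thesis
            by (simp add: power_mult_distrib)
        qed
        also have "\<dots> \<le> 6 * (1 / d m)"
          using d(2)[of m] by (intro mult_right_mono) auto
        finally show ?thesis
          using False mn by simp
      qed
    qed
    have same: "(\<Sum>m<N. of_bool (cluster m = k) * (1 / 4 ^ k)) \<le> (1::real)"
    proof -
      have "real (card {m\<in>{..<N}. cluster m = k}) \<le> real (4 ^ k)"
        by (intro of_nat_mono card_cluster_le) auto
      moreover have "(\<Sum>m<N. of_bool (cluster m = k) :: real) = real (card {m\<in>{..<N}. cluster m = k})"
        by (simp add: of_bool_def sum.If_cases Int_def)
      ultimately show ?thesis
        by (simp add: sum_distrib_right[symmetric] sum_divide_distrib[symmetric])
    qed
    have self: "(\<Sum>m<N. of_bool (m = n)) \<le> (1::real)"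
      by (simp add: of_bool_def)
    have other: "(\<Sum>m<N. 6 * (1 / d m)) \<le> 6 * S"
      unfolding sum_distrib_left[symmetric] S_def
      using summable_cluster_weights[of 8] d(2)
      by (intro mult_left_mono sum_le_suminf) (auto simp: d_def less_imp_le)
    have "(\<Sum>m<N. (cmod (dirichlet_gram ?z n m))\<^sup>2) \<le>
        (\<Sum>m<N. of_bool (m = n) + of_bool (cluster m = k) * (1 / 4 ^ k) + 6 * (1 / d m))"
      by (intro sum_mono bound)
    also have "\<dots> \<le> 1 + 1 + 6 * S"
      unfolding sum.distrib by (intro add_mono self same other)
    finally show "(\<Sum>m<N. (cmod (dirichlet_gram ?z n m))\<^sup>2) \<le> 1 + 1 + 6 * S" .
  qed
qed

text \<open>All of cluster \<open>k\<close> sits in the box of one arc of length \<open>exp (- (8 * 8 ^ k))\<close>. Its mass is of order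
\<open>4 ^ k / 16 ^ k\<close>, while the one box condition allows only a multiple of \<open>1 / 8 ^ k\<close>.\<close>

lemma not_one_box_cluster_seq: "\<not> one_box (cluster_seq 8)"
proof
  let ?z = "cluster_seq 8"
  assume "one_box ?z"
  then obtain C where "C > 0" and C: "\<And>I. is_circle_arc I \<Longrightarrow> 0 < arc_len I \<Longrightarrow> arc_len I < 1 \<Longrightarrow>
      measure (dirichlet_measure ?z) (carleson_box I) \<le> C * inverse (ln (1 / arc_len I))"
    by (auto simp: one_box_def)
  have "2 ^ j \<le> 16 * C" for j
  proof -
    define k where "k = Suc j"
    define l where "l = exp (- (8 * 8 ^ k :: real))"
    define I where "I = centred_arc (cis (1 / 2 ^ k)) l"
    have l: "0 < l" "l < 1"
      by (auto simp: l_def)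
    have len: "arc_len I = l"
      unfolding I_def using l by (intro arc_len_centred_arc) auto
    have cluster: "cluster m = k" if "m \<in> {4 ^ j..<4 ^ Suc j}" for m
      unfolding k_def using that by (intro cluster_eqI) auto
    have mem: "?z m \<in> carleson_box I" if "m \<in> {4 ^ j..<4 ^ Suc j}" for m
    proof -
      define x where "x = cluster_angle 8 m - 1 / 2 ^ k"
      have x: "0 \<le> x" "x \<le> l"
        using cluster_angle_bounds[of 8 m] cluster[OF that] by (auto simp: x_def l_def)
      have "?z m / of_real (cmod (?z m)) = cis (cluster_angle 8 m)"
        using cluster_seq_nonzero[of 8 m]
        unfolding norm_cluster_seq by (auto simp: cluster_seq_def)
      also have "\<dots> = cis (1 / 2 ^ k) * cis (2 * pi * (x / (2 * pi)))"
        by (simp add: cis_mult x_def)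
      also have "\<dots> \<in> I"
      proof -
        have "x \<le> l * pi"
          using x l pi_ge_two mult_left_mono[of 1 pi l] by linarith
        then have "\<bar>x / (2 * pi)\<bar> \<le> l / 2"
          using x by (simp add: field_simps)
        then show ?thesis
          unfolding I_def centred_arc_def by blast
      qed
      finally have "?z m / of_real (cmod (?z m)) \<in> I" .
      moreover have "8 * 8 ^ k \<le> 64 * (16::real) ^ k"
        by (intro mult_mono power_mono) auto
      then have "1 - cmod (?z m) \<le> l"
        by (simp add: norm_cluster_seq cluster[OF that] l_def depth_def)
      ultimately show ?thesis
        using cluster_seq_nonzero cluster_seq_in_disc by (simp add: carleson_box_def len)
    qed
    have "3 * 4 ^ j * (1 / (192 * 16 ^ k)) = (\<Sum>m\<in>{4 ^ j..<4 ^ Suc j::nat}. 1 / (192 * 16 ^ k :: real))"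
      by (simp add: of_nat_diff)
    also have "\<dots> \<le> (\<Sum>m\<in>{4 ^ j..<4 ^ Suc j::nat}. 1 / kernel_diag (?z m))"
    proof (intro sum_mono divide_left_mono)
      fix m :: nat assume m: "m \<in> {4 ^ j..<4 ^ Suc j}"
      show "kernel_diag (?z m) \<le> 192 * 16 ^ k"
        using kernel_diag_cluster_le[of 8 m] cluster[OF m] by simp
      show "0 < 192 * 16 ^ k * kernel_diag (?z m)"
        using kernel_diag_ge_half[OF cluster_seq_in_disc, of 8 m] by simp
    qed simp
    also have "\<dots> \<le> measure (dirichlet_measure ?z) (carleson_box I)"
      by (intro sum_le_measure_dirichlet cluster_seq_range finite_cluster_measure mem) auto
    also have "\<dots> \<le> C * inverse (ln (1 / arc_len I))"
      by (rule C) (use l len is_circle_arc_centred_arc in \<open>auto simp: I_def\<close>)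
    also have "ln (1 / arc_len I) = 8 * 8 ^ k"
      by (simp add: len l_def ln_div)
    finally have "3 * 4 ^ j * (1 / (192 * 16 ^ k)) \<le> C * inverse (8 * 8 ^ k)" .
    moreover have "(16::real) ^ j = 2 ^ j * 8 ^ j" "(4::real) ^ j = 2 ^ j * 2 ^ j"
      by (simp_all add: power_mult_distrib[symmetric])
    ultimately have "2 ^ j * 2 ^ j \<le> 16 * C * 2 ^ j"
      by (simp add: k_def field_simps)
    then show ?thesis
      by (rule mult_right_le_imp_le) simp
  qed
  moreover obtain j where "16 * C < 2 ^ j"
    using real_arch_pow[of 2 "16 * C"] by auto
  ultimately show False
    by (metis not_le)
qed

section \<open>Tightly packed clusters: restricted one box but not column bounded\<close>

text \<open>For \<open>b = 16\<close> the proximity within a cluster is a fixed proportion of the depth, so all entries of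
the Gram matrix within a cluster are bounded below, while the clusters grow.\<close>

lemma not_column_bounded_cluster_seq: "\<not> column_bounded (cluster_seq 16)"
proof
  let ?z = "cluster_seq 16"
  assume "column_bounded ?z"
  then obtain C where C: "\<And>n F. finite F \<Longrightarrow> (\<Sum>m\<in>F. (cmod (dirichlet_gram ?z n m))\<^sup>2) \<le> C"
    using column_boundedD by blast
  have "4 ^ j \<le> 2304 * C" for j
  proof -
    define k where "k = Suc j"
    have cluster: "cluster m = k" if "m \<in> {4 ^ j..<4 ^ Suc j}" for m
      unfolding k_def using that by (intro cluster_eqI) auto
    have n: "cluster (4 ^ j) = k"
      by (rule cluster) auto
    have "3 * 4 ^ j * (1 / 2304) = (\<Sum>m\<in>{4 ^ j..<4 ^ Suc j::nat}. 1 / 2304 :: real)"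
      by (simp add: of_nat_diff)
    also have "\<dots> \<le> (\<Sum>m\<in>{4 ^ j..<4 ^ Suc j}. (cmod (dirichlet_gram ?z (4 ^ j) m))\<^sup>2)"
    proof (intro sum_mono)
      fix m :: nat assume m: "m \<in> {4 ^ j..<4 ^ Suc j}"
      have "1 \<le> (16::real) ^ k"
        by simp
      then have K: "4 * 16 ^ k \<le> cmod (dirichlet_kernel (?z (4 ^ j)) (?z m))"
        using log_nearness_ge_same_cluster[of 16, OF _ _ n cluster[OF m]]
          kernel_norm_ge_log_nearness[OF cluster_seq_in_disc cluster_seq_in_disc, of 16 "4 ^ j" 16 m]
        by linarith
      have "1 / 2304 = (4 * 16 ^ k)\<^sup>2 / ((192 * 16 ^ k) * (192 * 16 ^ k) :: real)"
        by (simp add: power2_eq_square)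
      also have "\<dots> \<le> (cmod (dirichlet_gram ?z (4 ^ j) m))\<^sup>2"
        unfolding norm_gram_squared[OF cluster_seq_in_disc cluster_seq_in_disc]
        using K kernel_diag_cluster_le[of 16 m] kernel_diag_cluster_le[of 16 "4 ^ j"] cluster[OF m] n
          kernel_diag_ge_half[OF cluster_seq_in_disc, of 16 m]
          kernel_diag_ge_half[OF cluster_seq_in_disc, of 16 "4 ^ j"]
        by (intro frac_le power_mono mult_mono mult_pos_pos) auto
      finally show "1 / 2304 \<le> (cmod (dirichlet_gram ?z (4 ^ j) m))\<^sup>2" .
    qed
    also have "\<dots> \<le> C"
      by (rule C) simp
    finally show ?thesis
      using zero_le_power[of "4::real" j] by linarith
  qed
  moreover obtain j where "2304 * C < 4 ^ j"
    using real_arch_pow[of 4 "2304 * C"] by auto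
  ultimately show False
    by (metis not_le)
qed

section \<open>Comparison of the conditions\<close>

theorem theorem1p1:
  shows "(\<forall>z :: nat \<Rightarrow> complex. range z \<subseteq> ball 0 1 \<longrightarrow>
            (one_box z \<longrightarrow> column_bounded z) \<and> (column_bounded z \<longrightarrow> restricted_one_box z))
       \<and> (\<exists>z :: nat \<Rightarrow> complex. range z \<subseteq> ball 0 1 \<and> weakly_separated z \<and>
            column_bounded z \<and> \<not> one_box z)
       \<and> (\<exists>z :: nat \<Rightarrow> complex. range z \<subseteq> ball 0 1 \<and> weakly_separated z \<and>
            restricted_one_box z \<and> \<not> column_bounded z)"
proof (intro conjI)
  show "\<forall>z :: nat \<Rightarrow> complex. range z \<subseteq> ball 0 1 \<longrightarrow>
      (one_box z \<longrightarrow> column_bounded z) \<and> (column_bounded z \<longrightarrow> restricted_one_box z)"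
    using one_box_imp_column_bounded column_bounded_imp_restricted_one_box by blast
  show "\<exists>z :: nat \<Rightarrow> complex. range z \<subseteq> ball 0 1 \<and> weakly_separated z \<and>
      column_bounded z \<and> \<not> one_box z"
    using cluster_seq_range[of 8] weakly_separated_cluster_seq[of 8] column_bounded_cluster_seq
      not_one_box_cluster_seq by auto
  show "\<exists>z :: nat \<Rightarrow> complex. range z \<subseteq> ball 0 1 \<and> weakly_separated z \<and>
      restricted_one_box z \<and> \<not> column_bounded z"
    using cluster_seq_range[of 16] weakly_separated_cluster_seq[of 16]
      restricted_one_box_cluster_seq[of 16] not_column_bounded_cluster_seq by auto
qed

end
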